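(* Let $\mathcal U$ be a complex Banach space and let $\Psi=(\psi,s)$ be a Riesz evolution in $\mathcal U$, with $\overline\psi:\overline{\mathcal U}_\Psi\to\overline{\mathcal U}_\Psi$ the extension of $\psi$ to a Riesz operator. Then $\Psi$ is finitary. Moreover, $\Psi$ is mean ergodic if and only if $\Psi$ is stable. In particular, if $\Psi$ is stable, then $$\lim_{t\to\infty}\frac1t\sum_{m=1}^t\psi^m s=\begin{cases}0 & \text{if } \lambda=1 \text{ is not an eigenvalue of } \overline\psi,\\ P_1 s & \text{if } \lambda=1 \text{ is an eigenvalue of } \overline\psi,\end{cases}$$ where $P_1$ is a projection operator onto the eigenspace $E_1=\{x\in\overline{\mathcal U}_\Psi\mid \overline\psi x=x\}$.
   Context: An evolution $\Psi=(\psi,s)$ in a complex Banach space $\mathcal U$ consists of a linear operator $\psi$ on $\mathcal U$ and a vector $s\in\mathcal U$, and is identified with the sequence $(\psi^t s)_{t\ge 0}$. Its evolution space is $\mathcal U_\Psi=\mathrm{lin}\{\psi^t s\mid t=0,1,2,\dots\}$ (linear span), with closure $\overline{\mathcal U}_\Psi$ in $\mathcal U$. The dimension of $\Psi$ is $\dim\mathcal U_\Psi$; $\Psi$ is finite-dimensional if this is finite. $\Psi$ is stable if there is a real $c$ with $\|\psi^t s\|\le c\|s\|$ for all $t\ge0$. $\Psi$ is mean ergodic if the averages $\frac1t\sum_{m=1}^t\psi^m s$ converge in norm as $t\to\infty$. Two evolutions $(\varphi,v)$ and $(\psi,w)$ in $\mathcal U$ are equivalent if $\lim_{t\to\infty}\|\psi^t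 w-\varphi^t v\|=0$. $\Psi$ is finitary if it is equivalent to a finite-dimensional evolution in $\mathcal U$. A linear operator $T:V\to V$ on a complex normed space is a Riesz operator if $T$ is bounded, (a) each $\lambda\in\sigma(T)\setminus\{0\}$ is an eigenvalue of $T$ with finite algebraic multiplicity, and (b) $0$ is the only possible accumulation point of $\sigma(T)$; here $\sigma(T)$ is the set of $\lambda\in\mathbb C$ such that $T-\lambda$ is not invertible. $\Psi=(\psi,s)$ is a Riesz evolution if the restriction of $\psi$ to $\mathcal U_\Psi$ extends to a Riesz operator $\overline\psi:\overline{\mathcal U}_\Psi\to\overline{\mathcal U}_\Psi$. *)

theory Defs
  imports "HOL-Analysis.Analysis"
begin

section \<open>Complex Banach spaces\<close>

text \<open>The library only has normed spaces over the reals. The real structure underlying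
  a complex one is the restriction of scalars (axiom \<open>scaleC_of_real\<close>).\<close>

class complex_normed_vector = real_normed_vector +
  fixes scaleC :: "complex \<Rightarrow> 'a \<Rightarrow> 'a"  (infixr "*\<^sub>C" 75)
  assumes scaleC_add_right: "a *\<^sub>C (x + y) = a *\<^sub>C x + a *\<^sub>C y"
    and scaleC_add_left: "(a + b) *\<^sub>C x = a *\<^sub>C x + b *\<^sub>C x"
    and scaleC_scaleC: "a *\<^sub>C (b *\<^sub>C x) = (a * b) *\<^sub>C x"
    and scaleC_of_real: "complex_of_real r *\<^sub>C x = r *\<^sub>R x"
    and norm_scaleC: "norm (a *\<^sub>C x) = cmod a * norm x"

class complex_banach = complex_normed_vector + complete_space

subclass (in complex_banach) banach ..

instantiation complex :: complex_banach
begin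
definition scaleC_complex :: "complex \<Rightarrow> complex \<Rightarrow> complex" where
  "scaleC_complex a x = a * x"
instance
  by standard (auto simp: scaleC_complex_def algebra_simps norm_mult scaleR_conv_of_real)
end

interpretation complex_vector: vector_space "scaleC :: complex \<Rightarrow> 'a \<Rightarrow> 'a::complex_normed_vector"
proof
  show "1 *\<^sub>C x = x" for x :: 'a
    using scaleC_of_real[of 1 x] by simp
qed (simp_all add: scaleC_add_right scaleC_add_left scaleC_scaleC)

abbreviation clinear :: "('a::complex_normed_vector \<Rightarrow> 'b::complex_normed_vector) \<Rightarrow> bool" where
  "clinear \<equiv> Vector_Spaces.linear scaleC scaleC"

definition finite_dim :: "'a::complex_normed_vector set \<Rightarrow> bool" where
  "finite_dim S \<longleftrightarrow> (\<exists>B. finite B \<and> S \<subseteq> complex_vector.span B)"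


section \<open>Bounded operators on a subspace\<close>

text \<open>Operators \<open>V \<rightarrow> V\<close> on a complex subspace \<open>V\<close> are represented by functions on the ambient
  type whose values outside \<open>V\<close> are irrelevant.\<close>

definition bounded_operator_on :: "'a::complex_normed_vector set \<Rightarrow> ('a \<Rightarrow> 'a) \<Rightarrow> bool" where
  "bounded_operator_on V T \<longleftrightarrow>
     complex_vector.subspace V \<and>
     (\<forall>x\<in>V. T x \<in> V) \<and>
     (\<forall>x\<in>V. \<forall>y\<in>V. T (x + y) = T x + T y) \<and>
     (\<forall>a. \<forall>x\<in>V. T (a *\<^sub>C x) = a *\<^sub>C T x) \<and>
     (\<exists>K. \<forall>x\<in>V. norm (T x) \<le> K * norm x)"

text \<open>Invertibility is meant among the bounded operators. If \<open>V\<close> is complete, bijectivity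
  amounts to the same by the bounded inverse theorem.\<close>

definition invertible_on :: "'a::complex_normed_vector set \<Rightarrow> ('a \<Rightarrow> 'a) \<Rightarrow> bool" where
  "invertible_on V A \<longleftrightarrow> (\<exists>S. bounded_operator_on V S \<and> (\<forall>x\<in>V. S (A x) = x \<and> A (S x) = x))"

definition spectrum_on :: "'a::complex_normed_vector set \<Rightarrow> ('a \<Rightarrow> 'a) \<Rightarrow> complex set" where
  "spectrum_on V T = {z. \<not> invertible_on V (\<lambda>x. T x - z *\<^sub>C x)}"

definition eigenspace_on :: "'a::complex_normed_vector set \<Rightarrow> ('a \<Rightarrow> 'a) \<Rightarrow> complex \<Rightarrow> 'a set" where
  "eigenspace_on V T z = {x \<in> V. T x = z *\<^sub>C x}"

definition eigenvalue_on :: "'a::complex_normed_vector set \<Rightarrow> ('a \<Rightarrow> 'a) \<Rightarrow> complex \<Rightarrow> bool" where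
  "eigenvalue_on V T z \<longleftrightarrow> (\<exists>x \<in> eigenspace_on V T z. x \<noteq> 0)"

definition projection_onto :: "'a::complex_normed_vector set \<Rightarrow> 'a set \<Rightarrow> ('a \<Rightarrow> 'a) \<Rightarrow> bool" where
  "projection_onto V E P \<longleftrightarrow> bounded_operator_on V P \<and> P ` V = E \<and> (\<forall>x\<in>V. P (P x) = P x)"


section \<open>Algebraic multiplicity and Riesz operators\<close>

text \<open>The resolvent \<open>(z - T)\<inverse>\<close>, meaningful for \<open>z\<close> outside the spectrum and \<open>x \<in> V\<close>.\<close>

definition resolvent_on ::
  "'a::complex_normed_vector set \<Rightarrow> ('a \<Rightarrow> 'a) \<Rightarrow> complex \<Rightarrow> 'a \<Rightarrow> 'a" where
  "resolvent_on V T z x = (THE y. y \<in> V \<and> z *\<^sub>C y - T y = x)"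

text \<open>The spectral (Riesz) projection of an isolated point \<open>z\<close> of the spectrum, that is
  \<open>1 / (2 \<pi> \<i>)\<close> times the contour integral of the resolvent over the circle of radius \<open>r\<close>
  around \<open>z\<close>, written out in the parametrization \<open>z + r exp (2 \<pi> \<i> t)\<close>, whose derivative
  \<open>2 \<pi> \<i> r exp (2 \<pi> \<i> t)\<close> absorbs the factor \<open>1 / (2 \<pi> \<i>)\<close>.\<close>

definition spectral_projection ::
  "'a::complex_normed_vector set \<Rightarrow> ('a \<Rightarrow> 'a) \<Rightarrow> complex \<Rightarrow> real \<Rightarrow> 'a \<Rightarrow> 'a" where
  "spectral_projection V T z r x =
     integral {0..1} (\<lambda>t. (of_real r * cis (2 * pi * t)) *\<^sub>C
       resolvent_on V T (z + of_real r * cis (2 * pi * t)) x)"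

text \<open>The algebraic multiplicity of an isolated point of the spectrum is the rank of its spectral
  projection, which does not depend on the radius as long as the closed disc contains no other
  point of the spectrum. In infinite dimension this can exceed the dimension of the union of
  the kernels of the powers of \<open>T - z\<close>: for \<open>T = 1 + (Q \<oplus> 0)\<close> with \<open>Q\<close> the Volterra operator
  on \<open>L\<^sup>2(0,1)\<close> and \<open>0\<close> acting on the complex numbers, the spectrum is the eigenvalue \<open>1\<close> alone,
  the kernels have dimension one, and the spectral projection is the identity.\<close>

definition finite_algebraic_multiplicity ::
  "'a::complex_normed_vector set \<Rightarrow> ('a \<Rightarrow> 'a) \<Rightarrow> complex \<Rightarrow> bool" where
  "finite_algebraic_multiplicity V T z \<longleftrightarrow>
     (\<exists>r>0. cball z r \<inter> spectrum_on V T \<subseteq> {z} \<and> finite_dim (spectral_projection V T z r ` V))"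

definition riesz_operator_on :: "'a::complex_normed_vector set \<Rightarrow> ('a \<Rightarrow> 'a) \<Rightarrow> bool" where
  "riesz_operator_on V T \<longleftrightarrow>
     bounded_operator_on V T \<and>
     (\<forall>z \<in> spectrum_on V T - {0}. eigenvalue_on V T z \<and> finite_algebraic_multiplicity V T z) \<and>
     (\<forall>z. z islimpt spectrum_on V T \<longrightarrow> z = 0)"


section \<open>Evolutions\<close>

text \<open>An evolution is a linear operator \<open>\<psi>\<close>, not assumed bounded, together with a vector \<open>s\<close>;
  the notions below take both as arguments.\<close>

definition evolution_space :: "('a::complex_normed_vector \<Rightarrow> 'a) \<Rightarrow> 'a \<Rightarrow> 'a set" where
  "evolution_space \<psi> s = complex_vector.span (range (\<lambda>t. (\<psi> ^^ t) s))"

definition stable_evolution :: "('a::complex_normed_vector \<Rightarrow> 'a) \<Rightarrow> 'a \<Rightarrow> bool" where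
  "stable_evolution \<psi> s \<longleftrightarrow> (\<exists>c::real. \<forall>t. norm ((\<psi> ^^ t) s) \<le> c * norm s)"

definition evolution_average :: "('a::complex_normed_vector \<Rightarrow> 'a) \<Rightarrow> 'a \<Rightarrow> nat \<Rightarrow> 'a" where
  "evolution_average \<psi> s t = (1 / real t) *\<^sub>R (\<Sum>m = 1..t. (\<psi> ^^ m) s)"

definition mean_ergodic :: "('a::complex_normed_vector \<Rightarrow> 'a) \<Rightarrow> 'a \<Rightarrow> bool" where
  "mean_ergodic \<psi> s \<longleftrightarrow> convergent (evolution_average \<psi> s)"

definition equivalent_evolutions ::
  "('a::complex_normed_vector \<Rightarrow> 'a) \<Rightarrow> 'a \<Rightarrow> ('a \<Rightarrow> 'a) \<Rightarrow> 'a \<Rightarrow> bool" where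
  "equivalent_evolutions \<phi> v \<psi> w \<longleftrightarrow> (\<lambda>t. norm ((\<psi> ^^ t) w - (\<phi> ^^ t) v)) \<longlonglongrightarrow> 0"

definition finitary :: "('a::complex_normed_vector \<Rightarrow> 'a) \<Rightarrow> 'a \<Rightarrow> bool" where
  "finitary \<psi> s \<longleftrightarrow>
     (\<exists>\<phi> v. clinear \<phi> \<and> finite_dim (evolution_space \<phi> v) \<and> equivalent_evolutions \<psi> s \<phi> v)"

text \<open>\<open>(\<psi>, s)\<close> is a Riesz evolution iff such a \<open>T\<close> exists. Its values on the closure of the
  evolution space are then determined by continuity; off the evolution space itself they
  need not agree with those of \<open>\<psi>\<close>.\<close>

definition riesz_extension ::
  "('a::complex_normed_vector \<Rightarrow> 'a) \<Rightarrow> 'a \<Rightarrow> ('a \<Rightarrow> 'a) \<Rightarrow> bool" where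
  "riesz_extension \<psi> s T \<longleftrightarrow>
     (\<forall>x \<in> evolution_space \<psi> s. T x = \<psi> x) \<and>
     riesz_operator_on (closure (evolution_space \<psi> s)) T"

end

theory Submission
  imports Defs "HOL-Computational_Algebra.Fundamental_Theorem_Algebra"
begin

text \<open>The spectrum has only finitely many points outside the open unit disc, and each of them has a
  spectral projection of finite rank. Splitting them off one after the other writes
  \<open>s = e + w\<close> with \<open>e\<close> in a finite-dimensional invariant subspace and \<open>w\<close> in an invariant
  subspace on which the spectrum of \<open>T\<close> lies in the open unit disc, so that \<open>T\<^sup>t w\<close> decays
  exponentially. Hence the evolution is finitary.

  Both stability and mean ergodicity force \<open>T\<^sup>t s = o(t)\<close>. Since a polynomial in \<open>T\<close> annihilates
  \<open>e\<close>, peeling off its linear factors shows that an orbit of sublinear growth is a sum of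
  eigenvectors with unimodular eigenvalues and an exponentially decaying vector. This makes the
  orbit bounded and its averages converge to the eigenvector for the eigenvalue one. The latter is
  \<open>P s\<close> for the spectral projection \<open>P\<close> at one; as \<open>s\<close> generates the space, \<open>P\<close> maps onto
  the eigenspace.\<close>

text \<open>All contour integrals are moments of the resolvent over a circle about \<open>l\<close>,
  and one recursion governs them: feeding \<open>T - l\<close> into a moment raises its order by one
  (\<open>moment_shift\<close>). Order zero produces the splitting at \<open>l\<close>. Iterated
  along a backward chain, in which each vector is the image of the next under \<open>T - l\<close>,
  the recursion shows that \<open>P\<close> kills every component of \<open>s\<close> except the
  fixed one: the powers of the radius \<open>r\<close> beat the growth of the chain. For this the
  circle about 1 is shrunk according to the decomposition of \<open>s\<close>.

  The order o(t) is the threshold that matters, since a nontrivial Jordan block at a unimodular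
  eigenvalue grows at least linearly. For a mean ergodic evolution it comes from comparing
  consecutive averages.

  A spectral projection has its range, a priori, in a space of generalized eigenvectors. Here
  \<open>T (P x) = P x\<close> holds for \<open>x = s\<close>, hence along the orbit of
  \<open>s\<close>, hence on the closed span of the orbit, which is the whole space.\<close>

lemma bounded_bilinear_scaleC: "bounded_bilinear (scaleC :: complex \<Rightarrow> 'a::complex_normed_vector \<Rightarrow> 'a)"
proof
  show "(r *\<^sub>R a) *\<^sub>C b = r *\<^sub>R (a *\<^sub>C b)" "a *\<^sub>C (r *\<^sub>R b) = r *\<^sub>R (a *\<^sub>C b)"
    for r a and b :: 'a
    by (simp_all add: scaleR_conv_of_real scaleC_scaleC mult.commute flip: scaleC_of_real)
  show "\<exists>K. \<forall>a (b::'a). norm (a *\<^sub>C b) \<le> norm a * norm b * K"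
    by (rule exI[of _ 1]) (simp add: norm_scaleC)
qed (simp_all add: scaleC_add_left scaleC_add_right)

interpretation scaleC: bounded_bilinear "scaleC :: complex \<Rightarrow> 'a \<Rightarrow> 'a::complex_normed_vector"
  by (rule bounded_bilinear_scaleC)

lemma subspace_scaleR:
  "complex_vector.subspace V \<Longrightarrow> x \<in> V \<Longrightarrow> r *\<^sub>R x \<in> V" for x :: "'a::complex_normed_vector"
  by (metis complex_vector.subspace_scale scaleC_of_real)

section \<open>Bounded operators on a subspace\<close>

context
  fixes V :: "'a::complex_normed_vector set" and T
  assumes T: "bounded_operator_on V T"
begin

lemma bop_subspace: "complex_vector.subspace V"
  and bop_mem: "x \<in> V \<Longrightarrow> T x \<in> V"
  and bop_add: "x \<in> V \<Longrightarrow> y \<in> V \<Longrightarrow> T (x + y) = T x + T y"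
  and bop_scaleC: "x \<in> V \<Longrightarrow> T (a *\<^sub>C x) = a *\<^sub>C T x"
  using T unfolding bounded_operator_on_def by blast+

lemma bop_bound: obtains K where "K \<ge> 0" "\<And>x. x \<in> V \<Longrightarrow> norm (T x) \<le> K * norm x"
proof -
  obtain K where "\<forall>x\<in>V. norm (T x) \<le> K * norm x"
    using T unfolding bounded_operator_on_def by blast
  then have "norm (T x) \<le> \<bar>K\<bar> * norm x" if "x \<in> V" for x
    using that by (meson abs_ge_self mult_right_mono norm_ge_zero order_trans)
  then show ?thesis
    using that[of "\<bar>K\<bar>"] by simp
qed

lemma bop_zero: "T 0 = 0"
  using bop_scaleC[of 0 0] complex_vector.subspace_0[OF bop_subspace] by simp

lemma bop_diff: "x \<in> V \<Longrightarrow> y \<in> V \<Longrightarrow> T (x - y) = T x - T y"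
  using bop_add[of "x - y" y] complex_vector.subspace_diff[OF bop_subspace] by simp

lemma bop_scaleR: "x \<in> V \<Longrightarrow> T (r *\<^sub>R x) = r *\<^sub>R T x"
  using bop_scaleC[of x "of_real r"] by (simp add: scaleC_of_real)

lemma bop_sum: "(\<And>i. i \<in> I \<Longrightarrow> f i \<in> V) \<Longrightarrow> T (\<Sum>i\<in>I. f i) = (\<Sum>i\<in>I. T (f i))"
proof (induction I rule: infinite_finite_induct)
  case (insert i I)
  then show ?case
    using bop_add[of "f i" "sum f I"] complex_vector.subspace_sum[OF bop_subspace, of I f] by simp
qed (simp_all add: bop_zero)

lemma bop_funpow: "bounded_operator_on V (T ^^ n)"
proof (induction n)
  case 0
  then show ?case
    using bop_subspace unfolding bounded_operator_on_def by (auto intro!: exI[of _ 1])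
next
  case (Suc n)
  obtain K where K: "K \<ge> 0" "\<And>x. x \<in> V \<Longrightarrow> norm (T x) \<le> K * norm x"
    using bop_bound by blast
  from Suc obtain L where L: "\<And>x. x \<in> V \<Longrightarrow> norm ((T ^^ n) x) \<le> L * norm x"
    unfolding bounded_operator_on_def by blast
  have "norm ((T ^^ Suc n) x) \<le> (K * L) * norm x" if "x \<in> V" for x
  proof -
    have "(T ^^ n) x \<in> V" using that Suc unfolding bounded_operator_on_def by blast
    then show ?thesis
      using K(2)[of "(T ^^ n) x"] mult_left_mono[OF L[OF that] K(1)] by (simp add: mult.assoc)
  qed
  then show ?case
    using T Suc unfolding bounded_operator_on_def by auto
qed

lemma bop_funpow_mem: "x \<in> V \<Longrightarrow> (T ^^ n) x \<in> V"
  using bop_funpow unfolding bounded_operator_on_def by blast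

lemma bop_funpow_norm:
  assumes "K \<ge> 0" "\<And>x. x \<in> V \<Longrightarrow> norm (T x) \<le> K * norm x" "x \<in> V"
  shows "norm ((T ^^ n) x) \<le> K ^ n * norm x"
proof (induction n)
  case (Suc n)
  have "norm ((T ^^ Suc n) x) \<le> K * norm ((T ^^ n) x)"
    using assms(2)[OF bop_funpow_mem[OF assms(3)]] by simp
  also have "\<dots> \<le> K * (K ^ n * norm x)"
    using Suc assms(1) by (rule mult_left_mono)
  finally show ?case by (simp add: mult.assoc)
qed simp

lemma bop_continuous_on: "continuous_on V T"
proof -
  obtain K where K: "K \<ge> 0" "\<And>x. x \<in> V \<Longrightarrow> norm (T x) \<le> K * norm x"
    using bop_bound by blast
  have "K-lipschitz_on V T"
    by (rule lipschitz_onI[OF _ K(1)])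
      (metis K(2) bop_diff bop_subspace complex_vector.subspace_diff dist_norm)
  then show ?thesis by (rule lipschitz_on_continuous_on)
qed

lemma bop_tendsto:
  assumes "(f \<longlongrightarrow> x) F" "\<forall>\<^sub>F n in F. f n \<in> V" "x \<in> V"
  shows "((\<lambda>n. T (f n)) \<longlongrightarrow> T x) F"
  using continuous_on_tendsto_compose[OF bop_continuous_on assms(1,3,2)] .

end

lemma bop_comp:
  assumes A: "bounded_operator_on V A" and B: "bounded_operator_on V B"
  shows "bounded_operator_on V (\<lambda>x. A (B x))"
proof -
  obtain K where K: "K \<ge> 0" "\<And>x. x \<in> V \<Longrightarrow> norm (A x) \<le> K * norm x"
    using bop_bound[OF A] by blast
  obtain L where L: "L \<ge> 0" "\<And>x. x \<in> V \<Longrightarrow> norm (B x) \<le> L * norm x"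
    using bop_bound[OF B] by blast
  have "norm (A (B x)) \<le> (K * L) * norm x" if "x \<in> V" for x
    using K(2)[OF bop_mem[OF B that]] mult_left_mono[OF L(2)[OF that] K(1)] by (simp add: mult.assoc)
  then show ?thesis
    using A B unfolding bounded_operator_on_def by auto
qed

lemma bop_restrict:
  assumes "bounded_operator_on V T" "complex_vector.subspace W" "W \<subseteq> V" "\<And>x. x \<in> W \<Longrightarrow> T x \<in> W"
  shows "bounded_operator_on W T"
  using assms unfolding bounded_operator_on_def by (meson subsetD)

lemma funpow_commute_on:
  assumes "\<And>x. x \<in> V \<Longrightarrow> A x \<in> V" "\<And>x. x \<in> V \<Longrightarrow> B x \<in> V"
    and "\<And>x. x \<in> V \<Longrightarrow> A (B x) = B (A x)" and "x \<in> V"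
  shows "(A ^^ n) (B x) = B ((A ^^ n) x)"
proof -
  have "(A ^^ n) x \<in> V \<and> (A ^^ n) (B x) = B ((A ^^ n) x)"
    by (induction n) (use assms in auto)
  then show ?thesis ..
qed

section \<open>The resolvent\<close>

text \<open>A closed subspace of a Banach space is complete, which carries the fixed point
  arguments, and it contains the integrals of continuous curves in it. The locale serves for the
  closure of the evolution space and again for every subspace \<open>W\<close> split off from
  it.\<close>

locale closed_operator =
  fixes V :: "'a::complex_banach set" and T :: "'a \<Rightarrow> 'a"
  assumes bop: "bounded_operator_on V T" and closed: "closed V"
begin

abbreviation "\<sigma> \<equiv> spectrum_on V T"
abbreviation "R \<equiv> resolvent_on V T"

lemmas sub = bop_subspace[OF bop]
lemmas mem_add = complex_vector.subspace_add[OF sub]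
lemmas mem_diff = complex_vector.subspace_diff[OF sub]
lemmas mem_scale = complex_vector.subspace_scale[OF sub]
lemmas mem_scaleR = subspace_scaleR[OF sub]
lemmas mem_zero = complex_vector.subspace_0[OF sub]
lemmas mem_sum = complex_vector.subspace_sum[OF sub]
lemmas T_mem = bop_mem[OF bop]
lemmas T_add = bop_add[OF bop]
lemmas T_diff = bop_diff[OF bop]
lemmas T_scale = bop_scaleC[OF bop]
lemmas T_zero = bop_zero[OF bop]
lemmas T_sum = bop_sum[OF bop]
lemmas pow_bop = bop_funpow[OF bop]
lemmas pow_mem = bop_funpow_mem[OF bop]
lemmas pow_add = bop_add[OF pow_bop]
lemmas pow_diff = bop_diff[OF pow_bop]
lemmas pow_scale = bop_scaleC[OF pow_bop]
lemmas pow_sum = bop_sum[OF pow_bop]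

text \<open>The lower bound makes \<open>z - T\<close> injective and at the same time bounds the
  norm of its inverse; linearity of the pointwise chosen inverse follows from injectivity.\<close>

lemma not_in_spectrumI:
  assumes surj: "\<And>x. x \<in> V \<Longrightarrow> \<exists>y\<in>V. z *\<^sub>C y - T y = x"
    and below: "\<And>y. y \<in> V \<Longrightarrow> norm y \<le> K * norm (z *\<^sub>C y - T y)"
  shows "z \<notin> \<sigma>"
proof -
  obtain S where S: "\<And>x. x \<in> V \<Longrightarrow> S x \<in> V" "\<And>x. x \<in> V \<Longrightarrow> z *\<^sub>C S x - T (S x) = - x"
  proof -
    \<comment> \<open>The spectrum is defined through \<open>T - z\<close>, the resolvent through
      \<open>z - T\<close>; taking a preimage of \<open>- x\<close> accounts for the sign.\<close>
    have "\<forall>x\<in>V. \<exists>y. y \<in> V \<and> z *\<^sub>C y - T y = - x"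
      using surj[OF complex_vector.subspace_neg[OF sub]] by blast
    from bchoice[OF this] show ?thesis using that by blast
  qed
  have inj: "a = b" if "a \<in> V" "b \<in> V" "z *\<^sub>C a - T a = z *\<^sub>C b - T b" for a b
  proof -
    have "z *\<^sub>C (a - b) - T (a - b) = (z *\<^sub>C a - T a) - (z *\<^sub>C b - T b)"
      using that(1,2) by (simp add: T_diff complex_vector.scale_right_diff_distrib algebra_simps)
    then show ?thesis
      using below[OF mem_diff[OF that(1,2)]] that(3) by simp
  qed
  have 1: "T (S x) = z *\<^sub>C S x + x" if "x \<in> V" for x
    using S(2)[OF that] by (simp add: diff_eq_eq)
  have "bounded_operator_on V S"
    unfolding bounded_operator_on_def
  proof (intro conjI ballI allI exI[of _ K])
    show "S (x + y) = S x + S y" if "x \<in> V" "y \<in> V" for x y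
      by (rule inj) (use that S(1) in \<open>auto simp: 1 mem_add T_add scaleC_add_right\<close>)
    show "S (a *\<^sub>C x) = a *\<^sub>C S x" if "x \<in> V" for a x
      by (rule inj)
        (use that S(1) in \<open>auto simp: 1 mem_scale T_scale scaleC_add_right scaleC_scaleC mult.commute\<close>)
    show "norm (S x) \<le> K * norm x" if "x \<in> V" for x
      using below[OF S(1)[OF that]] S(2)[OF that] by simp
  qed (use S sub in auto)
  moreover have "S (T x - z *\<^sub>C x) = x \<and> T (S x) - z *\<^sub>C S x = x" if "x \<in> V" for x
  proof
    show "S (T x - z *\<^sub>C x) = x"
      by (rule inj) (use that S(1) in \<open>auto simp: 1 mem_diff mem_scale T_mem\<close>)
  qed (use 1[OF that] in simp)
  ultimately show ?thesis
    unfolding spectrum_on_def invertible_on_def by auto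
qed

lemma resolvent_eqI:
  assumes "z \<notin> \<sigma>" "y \<in> V" "z *\<^sub>C y - T y = x"
  shows "R z x = y"
proof -
  obtain S where S: "bounded_operator_on V S" "\<And>x. x \<in> V \<Longrightarrow> S (T x - z *\<^sub>C x) = x"
    using assms(1) unfolding spectrum_on_def invertible_on_def by auto
  have "y' = y" if "y' \<in> V" "z *\<^sub>C y' - T y' = x" for y'
  proof -
    have "T y' - z *\<^sub>C y' = T y - z *\<^sub>C y"
      using arg_cong[OF that(2)[folded assms(3)], of uminus] by simp
    then show ?thesis
      by (intro box_equals[OF arg_cong[where f = S] S(2)[OF that(1)] S(2)[OF assms(2)]])
  qed
  then show ?thesis
    unfolding resolvent_on_def using assms by (intro the_equality conjI) blast+
qed

context
  fixes z assumes z: "z \<notin> \<sigma>"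
begin

lemma resolvent_bop: "bounded_operator_on V (R z)"
  and resolvent_right: "x \<in> V \<Longrightarrow> z *\<^sub>C R z x - T (R z x) = x"
proof -
  obtain S where S: "bounded_operator_on V S" "\<And>x. x \<in> V \<Longrightarrow> T (S x) - z *\<^sub>C S x = x"
    using z unfolding spectrum_on_def invertible_on_def by auto
  have R: "R z x = - S x" if "x \<in> V" for x
  proof (rule resolvent_eqI[OF z])
    show "- S x \<in> V" using that S(1) bop_mem complex_vector.subspace_neg[OF sub] by blast
    show "z *\<^sub>C (- S x) - T (- S x) = x"
      using S(2)[OF that] T_scale[of "S x" "-1"] bop_mem[OF S(1) that] by simp
  qed
  then show "bounded_operator_on V (R z)"
    using S(1) sub unfolding bounded_operator_on_def
    by (simp add: mem_add mem_scale complex_vector.subspace_neg)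
  show "x \<in> V \<Longrightarrow> z *\<^sub>C R z x - T (R z x) = x"
    using S R T_scale[of "S x" "-1"] bop_mem[OF S(1)] by simp
qed

lemmas resolvent_mem = bop_mem[OF resolvent_bop]

lemma resolvent_left: "x \<in> V \<Longrightarrow> R z (z *\<^sub>C x - T x) = x"
  by (rule resolvent_eqI[OF z]) auto

lemma resolvent_commute:
  assumes B: "bounded_operator_on V B" and BT: "\<And>x. x \<in> V \<Longrightarrow> B (T x) = T (B x)" and x: "x \<in> V"
  shows "B (R z x) = R z (B x)"
proof (rule resolvent_eqI[OF z, symmetric])
  show "B (R z x) \<in> V" using bop_mem[OF B resolvent_mem[OF x]] .
  have "z *\<^sub>C B (R z x) - T (B (R z x)) = B (z *\<^sub>C R z x - T (R z x))"
    using x resolvent_mem by (simp add: bop_diff[OF B] bop_scaleC[OF B] BT mem_scale T_mem)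
  then show "z *\<^sub>C B (R z x) - T (B (R z x)) = B x"
    using resolvent_right[OF x] by simp
qed

text \<open>The equation \<open>w y - T y = x\<close> is equivalent to the fixed point equation
  \<open>y = R z (x - (w - z) y)\<close>, whose right-hand side contracts with factor 1/2. The same
  factor turns the bound \<open>M\<close> into \<open>2 * M\<close>.\<close>

lemma not_in_spectrum_perturb:
  assumes M: "M \<ge> 0" "\<And>x. x \<in> V \<Longrightarrow> norm (R z x) \<le> M * norm x"
    and w: "cmod (w - z) * M \<le> 1/2"
  shows "w \<notin> \<sigma>" and "x \<in> V \<Longrightarrow> norm (R w x) \<le> 2 * M * norm x"
proof -
  have below: "norm y \<le> 2 * M * norm (w *\<^sub>C y - T y)" if y: "y \<in> V" for y
  proof -
    have "y = R z ((w *\<^sub>C y - T y) - (w - z) *\<^sub>C y)"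
      using resolvent_left[OF y] by (simp add: complex_vector.scale_left_diff_distrib)
    then have "norm y \<le> M * norm ((w *\<^sub>C y - T y) - (w - z) *\<^sub>C y)"
      using M(2)[of "(w *\<^sub>C y - T y) - (w - z) *\<^sub>C y"] y by (simp add: mem_diff mem_scale T_mem)
    also have "\<dots> \<le> M * (norm (w *\<^sub>C y - T y) + cmod (w - z) * norm y)"
      using M(1) norm_triangle_ineq4[of "w *\<^sub>C y - T y" "(w - z) *\<^sub>C y"]
      by (intro mult_left_mono) (auto simp: norm_scaleC)
    also have "\<dots> \<le> M * norm (w *\<^sub>C y - T y) + norm y / 2"
      using mult_right_mono[OF w norm_ge_zero[of y]] by (simp add: algebra_simps)
    finally show ?thesis by simp
  qed
  show "w \<notin> \<sigma>"
  proof (rule not_in_spectrumI[OF _ below])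
    fix x assume x: "x \<in> V"
    let ?f = "\<lambda>y. R z (x - (w - z) *\<^sub>C y)"
    have "\<exists>!y\<in>V. ?f y = y"
    proof (rule Banach_fix[of V "1/2"])
      show "complete V" using closed complete_eq_closed by blast
      show "V \<noteq> {}" using x by auto
      show "?f ` V \<subseteq> V" using x by (auto intro!: resolvent_mem mem_diff mem_scale)
      show "dist (?f a) (?f b) \<le> 1/2 * dist a b" if "a \<in> V" "b \<in> V" for a b
      proof -
        have "?f a - ?f b = R z ((w - z) *\<^sub>C (b - a))"
          using that x
          by (simp add: mem_diff mem_scale complex_vector.scale_right_diff_distrib flip: bop_diff[OF resolvent_bop])
        then have "dist (?f a) (?f b) \<le> M * (cmod (w - z) * norm (b - a))"
          using M(2)[of "(w - z) *\<^sub>C (b - a)"] that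
          by (simp add: dist_norm mem_diff mem_scale norm_scaleC)
        also have "\<dots> \<le> 1/2 * dist a b"
          using mult_right_mono[OF w norm_ge_zero[of "b - a"]]
          by (simp add: dist_norm norm_minus_commute algebra_simps)
        finally show ?thesis .
      qed
    qed auto
    then obtain y where y: "y \<in> V" "y = ?f y" by metis
    have "z *\<^sub>C y - T y = x - (w - z) *\<^sub>C y"
      using y resolvent_right[of "x - (w - z) *\<^sub>C y"] x by (simp add: mem_diff mem_scale)
    then have "w *\<^sub>C y - T y = x"
      by (simp add: complex_vector.scale_left_diff_distrib algebra_simps)
    then show "\<exists>y\<in>V. w *\<^sub>C y - T y = x" using y by blast
  qed
  note w = this
  show "norm (R w x) \<le> 2 * M * norm x" if x: "x \<in> V"
  proof -
    obtain S where S: "bounded_operator_on V S" "\<And>x. x \<in> V \<Longrightarrow> T (S x) - w *\<^sub>C S x = x"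
      using w unfolding spectrum_on_def invertible_on_def by auto
    have m: "- S x \<in> V" using x S(1) bop_mem complex_vector.subspace_neg[OF sub] by blast
    have e: "w *\<^sub>C (- S x) - T (- S x) = x"
      using S(2)[OF x] T_scale[of "S x" "-1"] bop_mem[OF S(1) x] by simp
    then show ?thesis using below[OF m] resolvent_eqI[OF w m e] by simp
  qed
qed

end

lemma resolvent_identity:
  assumes "u \<notin> \<sigma>" "v \<notin> \<sigma>" "x \<in> V"
  shows "R u x - R v x = (v - u) *\<^sub>C R u (R v x)"
proof -
  have "R v x \<in> V" using assms resolvent_mem by blast
  have "R u x = R u (v *\<^sub>C R v x - T (R v x))"
    using resolvent_right[OF assms(2,3)] by simp
  also have "\<dots> = R u ((u *\<^sub>C R v x - T (R v x)) + (v - u) *\<^sub>C R v x)"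
    by (simp add: complex_vector.scale_left_diff_distrib)
  also have "\<dots> = R v x + (v - u) *\<^sub>C R u (R v x)"
    using \<open>R v x \<in> V\<close> resolvent_left[OF assms(1)]
    by (simp add: bop_add[OF resolvent_bop[OF assms(1)]] bop_scaleC[OF resolvent_bop[OF assms(1)]]
        mem_diff mem_scale T_mem)
  finally show ?thesis by simp
qed

text \<open>Around each point the perturbation bound holds on a small ball with twice the bound at
  the centre; finitely many such balls cover \<open>K\<close>.\<close>

lemma resolvent_bounded_on_compact:
  assumes "compact K" "K \<inter> \<sigma> = {}"
  obtains M where "M \<ge> 0" "\<And>z x. z \<in> K \<Longrightarrow> x \<in> V \<Longrightarrow> norm (R z x) \<le> M * norm x"
proof -
  have "\<exists>M\<ge>0. \<forall>x\<in>V. norm (R z x) \<le> M * norm x" if "z \<in> K" for z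
  proof -
    have "z \<notin> \<sigma>" using that assms(2) by blast
    from bop_bound[OF resolvent_bop[OF this]] show ?thesis by metis
  qed
  then have "\<forall>z\<in>K. \<exists>M. M \<ge> 0 \<and> (\<forall>x\<in>V. norm (R z x) \<le> M * norm x)"
    by blast
  from bchoice[OF this] obtain m where m: "\<And>z. z \<in> K \<Longrightarrow> m z \<ge> 0"
      "\<And>z x. z \<in> K \<Longrightarrow> x \<in> V \<Longrightarrow> norm (R z x) \<le> m z * norm x"
    by blast
  \<comment> \<open>The \<open>+ 1\<close> guards against \<open>m z = 0\<close>, where the radius
    would be \<open>1 / 0 = 0\<close> and the ball empty.\<close>
  let ?U = "\<lambda>z. ball z (1 / (2 * (m z + 1)))"
  have "K \<subseteq> (\<Union>z\<in>K. ?U z)"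
    using m(1) by (force intro: add_nonneg_pos)
  then obtain C where C: "C \<subseteq> K" "finite C" "K \<subseteq> (\<Union>z\<in>C. ?U z)"
    by (rule compactE_image[OF assms(1), of K ?U, rotated]) auto
  let ?M = "\<Sum>z\<in>C. 2 * m z"
  have "norm (R w x) \<le> ?M * norm x" if wx: "w \<in> K" "x \<in> V" for w x
  proof -
    obtain z where z: "z \<in> C" "w \<in> ?U z" using C(3) wx(1) by blast
    have mz: "m z \<ge> 0" using z C m by blast
    have "cmod (w - z) * m z \<le> 1 / (2 * (m z + 1)) * m z"
      using z mz by (intro mult_right_mono) (auto simp: dist_norm norm_minus_commute less_imp_le)
    also have "\<dots> \<le> 1/2" using mz by (simp add: field_simps)
    finally have *: "cmod (w - z) * m z \<le> 1/2" .
    have "norm (R w x) \<le> 2 * m z * norm x"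
      using not_in_spectrum_perturb(2)[OF _ mz _ * wx(2)] z C(1) assms(2) m(2) by blast
    also have "\<dots> \<le> ?M * norm x"
      using z C m(1) by (intro mult_right_mono member_le_sum) auto
    finally show ?thesis .
  qed
  moreover have "?M \<ge> 0" using C m(1) by (intro sum_nonneg) auto
  ultimately show ?thesis using that by blast
qed

lemma resolvent_continuous_on:
  assumes "K \<inter> \<sigma> = {}" "compact K" "x \<in> V"
  shows "continuous_on K (\<lambda>z. R z x)"
proof -
  obtain M where M: "M \<ge> 0" "\<And>z x. z \<in> K \<Longrightarrow> x \<in> V \<Longrightarrow> norm (R z x) \<le> M * norm x"
    using resolvent_bounded_on_compact[OF assms(2,1)] by blast
  have "(M * (M * norm x))-lipschitz_on K (\<lambda>z. R z x)"
  proof (rule lipschitz_onI)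
    fix u v assume uv: "u \<in> K" "v \<in> K"
    then have s: "u \<notin> \<sigma>" "v \<notin> \<sigma>" using assms by auto
    have "dist (R u x) (R v x) = cmod (v - u) * norm (R u (R v x))"
      using resolvent_identity[OF s assms(3)] by (simp add: dist_norm norm_scaleC)
    also have "\<dots> \<le> cmod (v - u) * (M * (M * norm x))"
      using M uv assms(3) resolvent_mem[OF s(2) assms(3)]
      by (intro mult_left_mono order_trans[OF M(2)]) auto
    finally show "dist (R u x) (R v x) \<le> M * (M * norm x) * dist u v"
      by (simp add: dist_norm norm_minus_commute mult.commute)
  qed (use M in auto)
  then show ?thesis by (rule lipschitz_on_continuous_on)
qed

text \<open>The threshold makes \<open>T / z\<close> a contraction with factor 1/2 and leaves room
  for the resolvent bound 1, which is uniform in \<open>z\<close>. It confines the spectrum to a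
  compact set and controls the resolvent on the unbounded region outside it.\<close>

lemma resolvent_outside:
  assumes "K \<ge> 0" "\<And>x. x \<in> V \<Longrightarrow> norm (T x) \<le> K * norm x" "cmod z \<ge> 2 * K + 2"
  shows "z \<notin> \<sigma>" and "x \<in> V \<Longrightarrow> norm (R z x) \<le> norm x"
proof -
  have z0: "z \<noteq> 0" using assms by auto
  have below: "norm y \<le> 1 * norm (z *\<^sub>C y - T y)" if "y \<in> V" for y
  proof -
    have "(2 * K + 2) * norm y \<le> norm (z *\<^sub>C y)"
      using mult_right_mono[OF assms(3) norm_ge_zero[of y]] by (simp add: norm_scaleC)
    also have "\<dots> \<le> norm (z *\<^sub>C y - T y) + K * norm y"
      using norm_triangle_sub[of "z *\<^sub>C y" "T y"] assms(2)[OF that] by linarith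
    finally have "(K + 1) * norm y + norm y \<le> norm (z *\<^sub>C y - T y)"
      by (simp add: algebra_simps)
    moreover have "(K + 1) * norm y \<ge> 0" using assms(1) by simp
    ultimately show ?thesis by linarith
  qed
  show nz: "z \<notin> \<sigma>"
  proof (rule not_in_spectrumI[OF _ below])
    fix x assume x: "x \<in> V"
    let ?f = "\<lambda>y. inverse z *\<^sub>C (x + T y)"
    have "\<exists>!y\<in>V. ?f y = y"
    proof (rule Banach_fix[of V "1/2"])
      show "complete V" using closed complete_eq_closed by blast
      show "V \<noteq> {}" using x by auto
      show "?f ` V \<subseteq> V" using x by (auto intro!: mem_add mem_scale T_mem)
      show "dist (?f a) (?f b) \<le> 1/2 * dist a b" if "a \<in> V" "b \<in> V" for a b
      proof -
        have "?f a - ?f b = inverse z *\<^sub>C T (a - b)"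
          using that by (simp add: T_diff complex_vector.scale_right_diff_distrib scaleC_add_right)
        then have "dist (?f a) (?f b) \<le> inverse (cmod z) * (K * norm (a - b))"
          using assms(2)[OF mem_diff[OF that]]
          by (simp add: dist_norm norm_scaleC norm_inverse mult_left_mono)
        also have "\<dots> = (inverse (cmod z) * K) * dist a b" by (simp add: dist_norm)
        also have "\<dots> \<le> 1/2 * dist a b"
          using assms z0 by (intro mult_right_mono) (auto simp: field_simps)
        finally show ?thesis .
      qed
    qed auto
    then obtain y where y: "y \<in> V" "y = ?f y" by metis
    have "z *\<^sub>C y = x + T y"
      by (subst y(2)) (use z0 in \<open>simp add: scaleC_scaleC\<close>)
    then show "\<exists>y\<in>V. z *\<^sub>C y - T y = x"
      using y(1) by (intro bexI[of _ y]) (simp_all add: diff_eq_eq)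
  qed
  show "norm (R z x) \<le> norm x" if "x \<in> V"
    using below[OF resolvent_mem[OF nz that]] resolvent_right[OF nz that] by simp
qed

end

section \<open>Contour integrals of the resolvent over a circle\<close>

text \<open>Riemann sums are linear combinations of values of \<open>f\<close>, so they lie in
  \<open>W\<close>, and the integral is approximated by them.\<close>

lemma integral_in_closed_subspace:
  fixes f :: "real \<Rightarrow> 'b::banach"
  assumes W: "closed W" "subspace W" and f: "continuous_on {0..1} f" "\<And>t. t \<in> {0..1} \<Longrightarrow> f t \<in> W"
  shows "integral {0..1} f \<in> W"
proof -
  have I: "(f has_integral integral {0..1} f) (cbox 0 1)"
    using integrable_continuous_real[OF f(1)] by (simp add: has_integral_integral)
  have "\<exists>y\<in>W. dist y (integral {0..1} f) < e" if e: "e > 0" for e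
  proof -
    obtain \<gamma> where \<gamma>: "gauge \<gamma>"
      "\<And>p. p tagged_division_of (cbox 0 1) \<Longrightarrow> \<gamma> fine p \<Longrightarrow>
        norm ((\<Sum>(x,k)\<in>p. measure lborel k *\<^sub>R f x) - integral {0..1} f) < e"
      by (rule has_integralD[OF I e]) blast
    obtain p where p: "p tagged_division_of (cbox 0 1)" "\<gamma> fine p"
      using fine_division_exists[OF \<gamma>(1)] by blast
    have "(\<Sum>(x,k)\<in>p. measure lborel k *\<^sub>R f x) \<in> W"
    proof (rule subspace_sum[OF W(2)])
      fix q assume q: "q \<in> p"
      obtain x k where xk: "q = (x, k)" by force
      have "x \<in> cbox 0 1"
        using tagged_division_ofD(2,3)[OF p(1)] q xk by blast
      then show "(case q of (x, k) \<Rightarrow> measure lborel k *\<^sub>R f x) \<in> W"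
        using f(2) W(2) xk by (simp add: subspace_scale)
    qed
    then show ?thesis using \<gamma>(2)[OF p] by (auto simp: dist_norm)
  qed
  then show ?thesis
    using closed_approachable[OF W(1)] by blast
qed

lemma subspace_of_complex_subspace:
  "complex_vector.subspace V \<Longrightarrow> subspace V" for V :: "'a::complex_normed_vector set"
  by (simp add: subspace_def complex_vector.subspace_0 complex_vector.subspace_add subspace_scaleR)

text \<open>The graph of \<open>B\<close> over \<open>V\<close> is a closed subspace, which reduces this to the previous lemma
  although \<open>B\<close> need not be linear outside \<open>V\<close>.\<close>

lemma bop_integral:
  fixes f :: "real \<Rightarrow> 'a::complex_banach"
  assumes B: "bounded_operator_on V B" and V: "closed V"
    and f: "continuous_on {0..1} f" "\<And>t. t \<in> {0..1} \<Longrightarrow> f t \<in> V"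
  shows "B (integral {0..1} f) = integral {0..1} (\<lambda>t. B (f t))"
proof -
  let ?W = "(\<lambda>x. (x, B x)) ` V"
  have "closed ?W"
    unfolding closed_sequential_limits
  proof (intro allI impI, elim conjE)
    fix g l assume g: "\<forall>n. g n \<in> ?W" and l: "g \<longlonglongrightarrow> l"
    have m: "fst (g n) \<in> V" "snd (g n) = B (fst (g n))" for n
      using g by (metis (mono_tags, lifting) fst_conv imageE snd_conv)+
    have l1: "(\<lambda>n. fst (g n)) \<longlonglongrightarrow> fst l" and l2: "(\<lambda>n. snd (g n)) \<longlonglongrightarrow> snd l"
      using l by (auto intro: tendsto_intros)
    have V1: "fst l \<in> V" using closed_sequentially[OF V, of "\<lambda>n. fst (g n)"] m(1) l1 by simp
    have "(\<lambda>n. B (fst (g n))) \<longlonglongrightarrow> B (fst l)"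
      using bop_tendsto[OF B l1 _ V1] m(1) by simp
    then have "snd l = B (fst l)"
      using LIMSEQ_unique[OF l2[unfolded m(2)]] by simp
    then show "l \<in> ?W" using V1 by (intro image_eqI[of _ _ "fst l"]) (simp_all add: prod_eq_iff)
  qed
  moreover have "subspace ?W"
    unfolding subspace_def
  proof (intro conjI allI ballI)
    show "0 \<in> ?W"
      using bop_zero[OF B] complex_vector.subspace_0[OF bop_subspace[OF B]]
      by (intro image_eqI[of _ _ 0]) (simp_all add: zero_prod_def)
    show "x + y \<in> ?W" if "x \<in> ?W" "y \<in> ?W" for x y
      using that by (auto simp: image_iff bop_add[OF B] complex_vector.subspace_add[OF bop_subspace[OF B]])
    show "c *\<^sub>R x \<in> ?W" if "x \<in> ?W" for c x
      using that by (auto simp: image_iff bop_scaleR[OF B] subspace_scaleR[OF bop_subspace[OF B]])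
  qed
  moreover have "continuous_on {0..1} (\<lambda>t. B (f t))"
    using continuous_on_compose2[OF bop_continuous_on[OF B] f(1)] f(2) by blast
  then have c: "continuous_on {0..1} (\<lambda>t. (f t, B (f t)))"
    using f(1) by (intro continuous_on_Pair)
  ultimately have W: "integral {0..1} (\<lambda>t. (f t, B (f t))) \<in> ?W"
    using f(2) by (intro integral_in_closed_subspace) auto
  have i: "(\<lambda>t. (f t, B (f t))) integrable_on {0..1}"
    using integrable_continuous_real[OF c] .
  have "integral {0..1} f = fst (integral {0..1} (\<lambda>t. (f t, B (f t))))"
    using integral_linear[OF i bounded_linear_fst] by (simp add: o_def)
  moreover have "integral {0..1} (\<lambda>t. B (f t)) = snd (integral {0..1} (\<lambda>t. (f t, B (f t))))"
    using integral_linear[OF i bounded_linear_snd] by (simp add: o_def)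
  ultimately show ?thesis using W by auto
qed

lemma scaleC_bop:
  assumes "complex_vector.subspace V"
  shows "bounded_operator_on V (\<lambda>x. a *\<^sub>C x)"
  unfolding bounded_operator_on_def
proof (intro conjI ballI allI exI[of _ "cmod a"])
  show "a *\<^sub>C x \<in> V" if "x \<in> V" for x
    using complex_vector.subspace_scale[OF assms that] .
  show "a *\<^sub>C b *\<^sub>C x = b *\<^sub>C a *\<^sub>C x" for b and x :: 'a
    by (simp only: scaleC_scaleC mult.commute)
qed (simp_all add: assms scaleC_add_right norm_scaleC)

definition circ :: "real \<Rightarrow> real \<Rightarrow> complex" where
  "circ r t = of_real r * cis (2 * pi * t)"

lemma norm_circ: "r \<ge> 0 \<Longrightarrow> cmod (circ r t) = r"
  by (simp add: circ_def norm_mult)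

lemma continuous_on_circ [continuous_intros]: "continuous_on A (circ r)"
  unfolding circ_def by (intro continuous_intros)

text \<open>The one contour integral that is evaluated explicitly; it produces the extra term
  \<open>x\<close> at \<open>m = 0\<close> in \<open>moment_shift\<close>.\<close>

lemma integral_circ_power:
  "integral {0..1} (\<lambda>t. circ r t ^ m) = (if m = 0 then 1 else 0)"
proof (cases "m = 0")
  case False
  let ?c = "\<i> * (2 * pi * m)"
  have c: "?c \<noteq> 0" using False by simp
  let ?F = "\<lambda>t. (of_real r ^ m * exp (?c * complex_of_real t) / ?c)"
  have eq: "circ r t ^ m = of_real r ^ m * exp (?c * complex_of_real t)" for t
    by (simp add: circ_def power_mult_distrib cis_conv_exp exp_of_nat_mult[symmetric] mult_ac)
  have "((\<lambda>t. circ r t ^ m) has_integral (?F 1 - ?F 0)) {0..1}"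
  proof (rule fundamental_theorem_of_calculus)
    fix t :: real
    have "((\<lambda>w. of_real r ^ m * exp (?c * w) / ?c) has_field_derivative circ r t ^ m) (at (complex_of_real t))"
      unfolding eq using c by (auto intro!: derivative_eq_intros)
    from has_vector_derivative_real_field[OF this]
    show "(?F has_vector_derivative circ r t ^ m) (at t within {0..1})" .
  qed simp
  moreover have "exp ?c = 1"
  proof -
    have "?c = of_int (2 * int m) * (of_real pi * \<i>)" by simp
    then show ?thesis using exp_integer_2pi[of "of_nat m"] by (simp add: mult_ac)
  qed
  then have "?F 1 - ?F 0 = 0" by simp
  ultimately show ?thesis using False by (auto simp: integral_unique)
qed simp

section \<open>Moments of the resolvent: commutation, boundedness and the recursion in the
  order\<close>

context closed_operator
begin

text \<open>In contour notation this is 1 / (2 pi i) times the integral of (z - l)^(m - 1) (z -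
  T)^(-1) x over the circle, one factor \<open>circ r t\<close> stemming from dz. If
  \<open>l\<close> is the only spectral point in the disc, these are coefficients of the Laurent
  expansion of the resolvent at \<open>l\<close>; order zero is its constant term.\<close>

definition moment :: "complex \<Rightarrow> real \<Rightarrow> nat \<Rightarrow> 'a \<Rightarrow> 'a" where
  "moment l r m x = integral {0..1} (\<lambda>t. circ r t ^ m *\<^sub>C R (l + circ r t) x)"

lemma spectral_projection_moment: "spectral_projection V T l r = moment l r 1"
  by (simp add: spectral_projection_def moment_def circ_def fun_eq_iff)

context
  fixes l :: complex and r :: real
  assumes r: "r > 0" and circle: "sphere l r \<inter> \<sigma> = {}"
begin

lemma on_circle: "l + circ r t \<in> sphere l r"
  using r by (simp add: dist_norm norm_circ)

lemma circle_notin: "l + circ r t \<notin> \<sigma>"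
  using on_circle circle by blast

lemma moment_integrand:
  assumes "x \<in> V"
  shows "continuous_on {0..1} (\<lambda>t. circ r t ^ m *\<^sub>C R (l + circ r t) x)"
    and "circ r t ^ m *\<^sub>C R (l + circ r t) x \<in> V"
proof -
  have "continuous_on {0..1} (\<lambda>t. R (l + circ r t) x)"
    by (rule continuous_on_compose2[OF resolvent_continuous_on[OF circle _ assms]])
      (use on_circle in \<open>auto intro!: continuous_intros\<close>)
  then show "continuous_on {0..1} (\<lambda>t. circ r t ^ m *\<^sub>C R (l + circ r t) x)"
    by (intro scaleC.continuous_on continuous_intros)
  show "circ r t ^ m *\<^sub>C R (l + circ r t) x \<in> V"
    by (intro mem_scale resolvent_mem[OF circle_notin] assms)
qed

lemma moment_integrable:
  "x \<in> V \<Longrightarrow> (\<lambda>t. circ r t ^ m *\<^sub>C R (l + circ r t) x) integrable_on {0..1}"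
  by (rule integrable_continuous_real[OF moment_integrand(1)])

text \<open>An operator passes through the integral by \<open>bop_integral\<close> and through the
  resolvent by \<open>resolvent_commute\<close>. Taking for \<open>B\<close> a scalar,
  \<open>T\<close> itself or the spectral projection gives homogeneity of the moments and their
  commutation with \<open>T\<close> and with that projection.\<close>

lemma moment_commute:
  assumes B: "bounded_operator_on V B" and BT: "\<And>x. x \<in> V \<Longrightarrow> B (T x) = T (B x)" and x: "x \<in> V"
  shows "B (moment l r m x) = moment l r m (B x)"
proof -
  have "B (moment l r m x) = integral {0..1} (\<lambda>t. B (circ r t ^ m *\<^sub>C R (l + circ r t) x))"
    unfolding moment_def using moment_integrand[OF x] by (intro bop_integral[OF B closed])
  also have "\<dots> = moment l r m (B x)"
    unfolding moment_def
    by (simp add: bop_scaleC[OF B] resolvent_mem[OF circle_notin] resolvent_commute[OF circle_notin B BT] x)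
  finally show ?thesis .
qed

lemma moment_norm:
  assumes "\<And>z x. z \<in> sphere l r \<Longrightarrow> x \<in> V \<Longrightarrow> norm (R z x) \<le> M * norm x" "x \<in> V"
  shows "norm (moment l r m x) \<le> r ^ m * (M * norm x)"
proof -
  have "norm (moment l r m x) \<le> (r ^ m * (M * norm x)) * (1 - 0)"
    unfolding moment_def
  proof (rule integral_bound)
    show "norm (circ r t ^ m *\<^sub>C R (l + circ r t) x) \<le> r ^ m * (M * norm x)" for t
      using assms(1)[OF on_circle assms(2)] r
      by (simp add: norm_scaleC norm_power norm_circ mult_left_mono)
  qed (use moment_integrand[OF assms(2)] in auto)
  then show ?thesis by simp
qed

lemma moment_bop: "bounded_operator_on V (moment l r m)"
proof -
  obtain M where M: "\<And>z x. z \<in> sphere l r \<Longrightarrow> x \<in> V \<Longrightarrow> norm (R z x) \<le> M * norm x"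
    using resolvent_bounded_on_compact[OF compact_sphere circle] by blast
  note R = resolvent_bop[OF circle_notin]
  show ?thesis
    unfolding bounded_operator_on_def
  proof (intro conjI ballI allI exI[of _ "r ^ m * M"])
    fix x assume x: "x \<in> V"
    show "moment l r m x \<in> V"
      unfolding moment_def
      by (intro integral_in_closed_subspace closed subspace_of_complex_subspace sub moment_integrand x)
    show "norm (moment l r m x) \<le> r ^ m * M * norm x"
      using moment_norm[OF M x] by (simp add: mult.assoc)
    show "moment l r m (a *\<^sub>C x) = a *\<^sub>C moment l r m x" for a
      using moment_commute[OF scaleC_bop[OF sub, of a] _ x, of m] T_scale by simp
    show "moment l r m (x + y) = moment l r m x + moment l r m y" if y: "y \<in> V" for y
      unfolding moment_def
      by (simp add: bop_add[OF R x y] scaleC_add_right integral_add moment_integrable x y)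
  qed (rule sub)
qed

text \<open>The moment of order one is the spectral projection \<open>P\<close>; for \<open>m = 0\<close> this says that the
  moment of order zero inverts \<open>T - l\<close> up to \<open>P\<close>.\<close>

lemma moment_shift:
  assumes x: "x \<in> V"
  shows "moment l r m (T x - l *\<^sub>C x) = moment l r (Suc m) x - (if m = 0 then x else 0)"
proof -
  have "circ r t ^ m *\<^sub>C R (l + circ r t) (T x - l *\<^sub>C x) =
      circ r t ^ Suc m *\<^sub>C R (l + circ r t) x - circ r t ^ m *\<^sub>C x" for t
  proof -
    let ?z = "l + circ r t"
    have "circ r t *\<^sub>C R ?z x = R ?z (circ r t *\<^sub>C x)"
      by (simp add: bop_scaleC[OF resolvent_bop[OF circle_notin]] x)
    also have "circ r t *\<^sub>C x = (T x - l *\<^sub>C x) + (?z *\<^sub>C x - T x)"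
      by (simp add: scaleC_add_left)
    also have "R ?z \<dots> = R ?z (T x - l *\<^sub>C x) + R ?z (?z *\<^sub>C x - T x)"
      by (intro bop_add[OF resolvent_bop[OF circle_notin]] mem_diff mem_scale T_mem x)
    also have "R ?z (?z *\<^sub>C x - T x) = x"
      by (rule resolvent_left[OF circle_notin x])
    finally have "R ?z (T x - l *\<^sub>C x) = circ r t *\<^sub>C R ?z x - x"
      by simp
    then show ?thesis
      by (simp add: complex_vector.scale_right_diff_distrib scaleC_scaleC mult.commute)
  qed
  moreover have c: "(\<lambda>t. circ r t ^ m) integrable_on {0..1}"
    by (intro integrable_continuous_real continuous_intros)
  then have "(\<lambda>t. circ r t ^ m *\<^sub>C x) integrable_on {0..1}"
      "integral {0..1} (\<lambda>t. circ r t ^ m *\<^sub>C x) = (if m = 0 then x else 0)"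
    using integral_linear[OF c scaleC.bounded_linear_left[of x]]
      integrable_linear[OF c scaleC.bounded_linear_left[of x]]
    by (auto simp: o_def integral_circ_power)
  ultimately show ?thesis
    unfolding moment_def by (simp add: integral_diff moment_integrable[OF x, of "Suc m"] del: power_Suc)
qed

lemma T_moment: "x \<in> V \<Longrightarrow> T (moment l r m x) = moment l r m (T x)"
  by (rule moment_commute[OF bop]) auto

end

end

section \<open>Splitting off a point of the spectrum\<close>

lemma bop_sum_ops:
  assumes "complex_vector.subspace V" "finite I" "\<And>i. i \<in> I \<Longrightarrow> bounded_operator_on V (A i)"
  shows "bounded_operator_on V (\<lambda>x. \<Sum>i\<in>I. A i x)"
  unfolding bounded_operator_on_def
proof (intro conjI ballI allI)
  have "\<forall>i\<in>I. \<exists>K. \<forall>x\<in>V. norm (A i x) \<le> K * norm x"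
    using assms(3) unfolding bounded_operator_on_def by blast
  from bchoice[OF this] obtain K where K: "\<And>i x. i \<in> I \<Longrightarrow> x \<in> V \<Longrightarrow> norm (A i x) \<le> K i * norm x"
    by blast
  have "norm (\<Sum>i\<in>I. A i x) \<le> sum K I * norm x" if "x \<in> V" for x
    using K that by (auto simp: sum_distrib_right intro!: sum_norm_le)
  then show "\<exists>K. \<forall>x\<in>V. norm (\<Sum>i\<in>I. A i x) \<le> K * norm x" by blast
  show "(\<Sum>i\<in>I. A i x) \<in> V" if "x \<in> V" for x
    using assms that by (intro complex_vector.subspace_sum) (auto intro: bop_mem)
  show "(\<Sum>i\<in>I. A i (x + y)) = (\<Sum>i\<in>I. A i x) + (\<Sum>i\<in>I. A i y)" if "x \<in> V" "y \<in> V" for x y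
    using that by (simp add: bop_add[OF assms(3)] sum.distrib)
  show "(\<Sum>i\<in>I. A i (a *\<^sub>C x)) = a *\<^sub>C (\<Sum>i\<in>I. A i x)" if "x \<in> V" for a x
    using that by (simp add: bop_scaleC[OF assms(3)] complex_vector.scale_sum_right)
qed (rule assms(1))

lemma complex_dim_psubset:
  assumes "complex_vector.subspace S" "S \<subset> W" "finite_dim W"
  shows "complex_vector.dim S < complex_vector.dim W"
proof -
  obtain B where B: "finite B" "W \<subseteq> complex_vector.span B"
    using assms(3) unfolding finite_dim_def by blast
  obtain B1 where B1: "B1 \<subseteq> S" "complex_vector.independent B1" "S \<subseteq> complex_vector.span B1"
      "card B1 = complex_vector.dim S"
    using complex_vector.basis_exists by blast
  have "B1 \<subseteq> W" using B1 assms by blast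
  then obtain B2 where B2: "B1 \<subseteq> B2" "B2 \<subseteq> W" "complex_vector.independent B2"
      "W \<subseteq> complex_vector.span B2"
    using complex_vector.maximal_independent_subset_extend[OF _ B1(2)] by blast
  have "finite B2"
    using complex_vector.independent_span_bound[OF B(1) B2(3)] B2(2) B(2) by blast
  moreover have "B1 \<noteq> B2"
  proof
    assume "B1 = B2"
    then have "W \<subseteq> S"
      using complex_vector.span_minimal[OF B1(1) assms(1)] B2(4) by blast
    then show False using assms(2) by blast
  qed
  ultimately have "card B1 < card B2"
    using B2(1) by (intro psubset_card_mono) auto
  moreover have "card B2 = complex_vector.dim W"
    using complex_vector.basis_card_eq_dim[OF B2(2,4,3)] .
  ultimately show ?thesis using B1(4) by simp
qed

lemma finite_dim_subset: "finite_dim W \<Longrightarrow> S \<subseteq> W \<Longrightarrow> finite_dim S"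
  unfolding finite_dim_def by blast

lemma bop_image_subspace:
  assumes "bounded_operator_on V A"
  shows "complex_vector.subspace (A ` V)"
proof -
  note s = bop_subspace[OF assms]
  show ?thesis
    unfolding complex_vector.subspace_def
  proof (intro conjI allI ballI)
    show "0 \<in> A ` V"
      using bop_zero[OF assms] complex_vector.subspace_0[OF s] by (metis image_eqI)
    show "x + y \<in> A ` V" if xy: "x \<in> A ` V" "y \<in> A ` V" for x y
    proof -
      obtain a b where "a \<in> V" "b \<in> V" "x = A a" "y = A b" using xy by blast
      then show ?thesis
        using complex_vector.subspace_add[OF s] bop_add[OF assms] by (intro image_eqI[of _ _ "a + b"]) auto
    qed
    show "c *\<^sub>C x \<in> A ` V" if x: "x \<in> A ` V" for c x
    proof -
      obtain a where "a \<in> V" "x = A a" using x by blast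
      then show ?thesis
        using complex_vector.subspace_scale[OF s] bop_scaleC[OF assms] by (intro image_eqI[of _ _ "c *\<^sub>C a"]) auto
    qed
  qed
qed

text \<open>The ranges of the powers decrease, and every strict inclusion lowers the dimension; one
  equality between neighbours makes the sequence constant from there on. Counting starts at the
  first power because the range of \<open>P ^^ 0\<close> is \<open>V\<close>, which may have
  infinite dimension.\<close>

lemma finite_rank_range_stable:
  assumes P: "bounded_operator_on V P" and fin: "finite_dim (P ` V)"
  obtains n where "n \<ge> 1" "(P ^^ n) ` V = (P ^^ (n + n)) ` V"
proof -
  let ?D = "\<lambda>k. (P ^^ k) ` V"
  have D: "?D (Suc k) \<subseteq> ?D k" for k
    using bop_mem[OF P] by (auto simp: funpow_swap1 simp del: funpow.simps(2) simp add: funpow_Suc_right)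
  have Dfin: "finite_dim (?D k)" if "k \<ge> 1" for k
    using that
  proof (induction k rule: nat_induct_at_least)
    case (Suc k)
    then show ?case using D finite_dim_subset by blast
  qed (use fin in simp)
  have "\<exists>k\<ge>1. ?D (Suc k) = ?D k"
  proof (rule ccontr)
    assume "\<not> ?thesis"
    then have psub: "?D (Suc k) \<subset> ?D k" if "k \<ge> 1" for k using D that by blast
    have less: "complex_vector.dim (?D (Suc k)) < complex_vector.dim (?D k)" if "k \<ge> 1" for k
      by (rule complex_dim_psubset[OF bop_image_subspace[OF bop_funpow[OF P]] psub[OF that] Dfin[OF that]])
    have "complex_vector.dim (?D (Suc k)) + k \<le> complex_vector.dim (?D 1)" for k
    proof (induction k)
      case (Suc k)
      then show ?case using less[of "Suc k"] by linarith
    qed simp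
    from this[of "Suc (complex_vector.dim (?D 1))"] show False by linarith
  qed
  then obtain k where k: "k \<ge> 1" "?D (Suc k) = ?D k" by blast
  have "?D (k + j) = ?D k" for j
  proof (induction j)
    case (Suc j)
    have "?D (k + Suc j) = P ` ?D (k + j)" by (simp add: image_comp)
    also have "\<dots> = ?D (Suc k)" unfolding Suc by (simp add: image_comp)
    finally show ?case using k(2) by simp
  qed simp
  then show ?thesis using that[OF k(1)] by metis
qed

context closed_operator
begin

text \<open>A power of the spectral projection \<open>P\<close> is already enough for Fitting's decomposition
  \<open>V = P\<^sup>n V + ker P\<^sup>n\<close>; that \<open>P\<close> is idempotent is not used. On \<open>ker P\<^sup>n\<close> the operator \<open>1 - P\<close>
  is inverted by a finite geometric series.\<close>

lemma split_spectral_point: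
  assumes r: "r > 0" and disc: "cball l r \<inter> \<sigma> \<subseteq> {l}"
    and fin: "finite_dim (spectral_projection V T l r ` V)"
  obtains E W where
    "complex_vector.subspace E" "E \<subseteq> V" "finite_dim E" "\<And>x. x \<in> E \<Longrightarrow> T x \<in> E"
    "W \<subseteq> V" "closed_operator W T" "spectrum_on W T \<subseteq> \<sigma> - {l}"
    "\<And>z x. z \<notin> \<sigma> \<Longrightarrow> x \<in> W \<Longrightarrow> resolvent_on W T z x = R z x"
    "\<And>x. x \<in> V \<Longrightarrow> \<exists>e\<in>E. \<exists>w\<in>W. x = e + w"
proof -
  have circle: "sphere l r \<inter> \<sigma> = {}"
    using disc r by (auto simp: subset_iff)
  define P where "P = moment l r 1"
  define S where "S = moment l r 0"
  have proj: "spectral_projection V T l r = P"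
    by (simp only: P_def spectral_projection_moment)
  note P = moment_bop[OF r circle, of 1, folded P_def] and S = moment_bop[OF r circle, of 0, folded S_def]
  have TP: "T (P x) = P (T x)" if "x \<in> V" for x
    unfolding P_def using T_moment[OF r circle that] .
  have PS: "P (S x) = S (P x)" if "x \<in> V" for x
    using moment_commute[OF r circle P TP[symmetric] that, of 0, folded S_def] .
  have TPn: "T ((P ^^ n) x) = (P ^^ n) (T x)" if "x \<in> V" for n x
    using funpow_commute_on[of V P T x n] bop_mem[OF P] T_mem TP that by simp
  obtain n where n: "n \<ge> 1" "(P ^^ n) ` V = (P ^^ (n + n)) ` V"
    using finite_rank_range_stable[OF P fin[unfolded proj]] by blast
  define W where "W = {x \<in> V. (P ^^ n) x = 0}"
  note Pn = bop_funpow[OF P, of n]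
  have W_V: "W \<subseteq> V" by (auto simp: W_def)
  have W_sub: "complex_vector.subspace W"
    unfolding complex_vector.subspace_def W_def
    using mem_zero mem_add mem_scale by (auto simp: bop_zero[OF Pn] bop_add[OF Pn] bop_scaleC[OF Pn])
  have W_inv: "B x \<in> W" if B: "\<And>x. x \<in> V \<Longrightarrow> B x \<in> V" "B 0 = 0"
    "\<And>x. x \<in> V \<Longrightarrow> P (B x) = B (P x)" "x \<in> W" for B x
    using funpow_commute_on[of V P B x n] bop_mem[OF P] that by (auto simp: W_def)
  have "closed W"
    unfolding W_def by (rule continuous_closed_preimage_constant[OF bop_continuous_on[OF Pn] closed])
  moreover have T_W: "bounded_operator_on W T"
    using W_inv[OF T_mem T_zero TP[symmetric]] by (intro bop_restrict[OF bop W_sub W_V])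
  ultimately have W_op: "closed_operator W T" by unfold_locales
  interpret W: closed_operator W T by (rule W_op)
  have R_W: "R z x \<in> W" if z: "z \<notin> \<sigma>" and "x \<in> W" for z x
    using W_inv[OF resolvent_mem[OF z] bop_zero[OF resolvent_bop[OF z]]
        resolvent_commute[OF z P TP[symmetric]]] that by blast
  have spec_z: "z \<notin> W.\<sigma>" if z: "z \<notin> \<sigma>" for z
  proof -
    obtain K where K: "\<And>x. x \<in> V \<Longrightarrow> norm (R z x) \<le> K * norm x"
      using bop_bound[OF resolvent_bop[OF z]] by blast
    show ?thesis
    proof (rule W.not_in_spectrumI)
      show "\<exists>y\<in>W. z *\<^sub>C y - T y = x" if "x \<in> W" for x
        using R_W[OF z that] resolvent_right[OF z, of x] that W_V by blast
      show "norm y \<le> K * norm (z *\<^sub>C y - T y)" if "y \<in> W" for y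
        using K[of "z *\<^sub>C y - T y"] resolvent_left[OF z, of y] that W_V
        by (simp add: subset_iff mem_diff mem_scale T_mem)
    qed
  qed
  \<comment> \<open>Agreement of the resolvents makes spectral projections of \<open>W\<close>
    restrictions of those of \<open>V\<close>, so that multiplicities stay finite when the splitting
    is repeated inside \<open>W\<close>.\<close>
  have res: "W.R z x = R z x" if "z \<notin> \<sigma>" "x \<in> W" for z x
    using W.resolvent_eqI[OF spec_z[OF that(1)] R_W[OF that]] resolvent_right[OF that(1), of x] W_V that(2)
    by blast
  have shift: "S (l *\<^sub>C x - T x) = x - P x" if "x \<in> V" for x
  proof -
    have "S (l *\<^sub>C x - T x) = - S (T x - l *\<^sub>C x)"
      using that by (simp add: bop_diff[OF S] mem_scale T_mem)
    then show ?thesis using moment_shift[OF r circle that, of 0] by (simp add: S_def P_def)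
  qed
  have shift': "l *\<^sub>C S x - T (S x) = x - P x" if "x \<in> V" for x
    using shift[OF that] that T_moment[OF r circle that, of 0, folded S_def]
    by (simp add: bop_diff[OF S] bop_scaleC[OF S] mem_scale T_mem)
  \<comment> \<open>The inverse of \<open>l - T\<close> on \<open>W\<close>: composing
    \<open>l - T\<close> with \<open>S\<close> gives \<open>1 - P\<close>, and the geometric sum of
    the powers of \<open>P\<close> inverts \<open>1 - P\<close> where \<open>P ^^ n\<close>
    vanishes.\<close>
  let ?B = "\<lambda>x. \<Sum>j<n. (P ^^ j) (S x)"
  have B: "bounded_operator_on V ?B"
    by (intro bop_sum_ops sub bop_comp[OF bop_funpow[OF P] S]) simp
  have BP: "P (?B x) = ?B (P x)" if "x \<in> V" for x
    using that by (simp add: bop_sum[OF P] bop_funpow_mem[OF P] bop_mem[OF S] funpow_swap1 flip: PS)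
  have tele: "(\<Sum>j<n. (P ^^ j) (x - P x)) = x" if "x \<in> W" for x
  proof -
    have xV: "x \<in> V" and x0: "(P ^^ n) x = 0" using that by (auto simp: W_def)
    have "(\<Sum>j<n. (P ^^ j) (x - P x)) = (\<Sum>j<n. (P ^^ j) x - (P ^^ Suc j) x)"
      using xV by (simp add: bop_diff[OF bop_funpow[OF P]] bop_mem[OF P] funpow_swap1)
    also have "\<dots> = x - (P ^^ n) x" by (subst sum_lessThan_telescope') simp
    finally show ?thesis using x0 by simp
  qed
  have "l \<notin> W.\<sigma>"
  proof -
    obtain K where K: "\<And>x. x \<in> V \<Longrightarrow> norm (?B x) \<le> K * norm x"
      using bop_bound[OF B] by blast
    show ?thesis
    proof (rule W.not_in_spectrumI)
      fix x assume x: "x \<in> W"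
      then have xV: "x \<in> V" using W_V by blast
      have "l *\<^sub>C ?B x - T (?B x) = (\<Sum>j<n. l *\<^sub>C (P ^^ j) (S x) - T ((P ^^ j) (S x)))"
        using xV by (simp add: sum_subtractf complex_vector.scale_sum_right T_sum
            bop_funpow_mem[OF P] bop_mem[OF S])
      also have "\<dots> = (\<Sum>j<n. (P ^^ j) (l *\<^sub>C S x - T (S x)))"
        using xV by (simp add: bop_diff[OF bop_funpow[OF P]] bop_scaleC[OF bop_funpow[OF P]] TPn
            bop_mem[OF S] T_mem mem_scale)
      also have "\<dots> = x" using shift'[OF xV] tele[OF x] by simp
      finally show "\<exists>y\<in>W. l *\<^sub>C y - T y = x"
        using W_inv[of ?B x, OF bop_mem[OF B] bop_zero[OF B] BP x] by blast
    next
      fix y assume y: "y \<in> W"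
      then have yV: "y \<in> V" using W_V by blast
      have "?B (l *\<^sub>C y - T y) = y" using shift[OF yV] tele[OF y] by simp
      then show "norm y \<le> K * norm (l *\<^sub>C y - T y)"
        using K[of "l *\<^sub>C y - T y"] yV by (simp add: mem_diff mem_scale T_mem)
    qed
  qed
  then have spec: "W.\<sigma> \<subseteq> \<sigma> - {l}" using spec_z by blast
  have split: "\<exists>e\<in>P ` V. \<exists>w\<in>W. x = e + w" if x: "x \<in> V" for x
  proof -
    have "(P ^^ n) x \<in> (P ^^ (n + n)) ` V" using n(2) x by blast
    then obtain y where y: "y \<in> V" "(P ^^ n) x = (P ^^ n) ((P ^^ n) y)"
      by (auto simp: funpow_add)
    have m: "(P ^^ n) y \<in> V" using bop_funpow_mem[OF P y(1)] .
    have "x - (P ^^ n) y \<in> W"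
      using x m y(2) by (simp add: W_def mem_diff bop_diff[OF Pn])
    \<comment> \<open>Since \<open>n \<ge> 1\<close>, the range of \<open>P ^^ n\<close> lies in the
      range of \<open>P\<close>, the space known to be finite-dimensional.\<close>
    moreover obtain k where "n = Suc k" using n(1) by (cases n) auto
    then have "(P ^^ n) y \<in> P ` V" using bop_funpow_mem[OF P y(1)] by simp
    ultimately show ?thesis
      by (intro bexI[of _ "(P ^^ n) y"] bexI[of _ "x - (P ^^ n) y"]) simp_all
  qed
  show ?thesis
  proof (rule that[of "P ` V" W])
    show "T x \<in> P ` V" if "x \<in> P ` V" for x using that TP T_mem by auto
    show "finite_dim (P ` V)" using fin proj by simp
  qed (use bop_image_subspace[OF P] bop_mem[OF P] W_V W_op spec res split in auto)
qed

end

section \<open>Decay of the powers\<close>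

text \<open>Decay of a single orbit, with constants that depend on the vector. A positive rate
  allows division by its powers.\<close>

definition exp_decay :: "('a::complex_normed_vector \<Rightarrow> 'a) \<Rightarrow> 'a \<Rightarrow> bool" where
  "exp_decay T x \<longleftrightarrow> (\<exists>C \<rho>. 0 < \<rho> \<and> \<rho> < 1 \<and> (\<forall>t. norm ((T ^^ t) x) \<le> C * \<rho> ^ t))"

lemma exp_decayI_eventually:
  assumes \<rho>: "0 < \<rho>" "\<rho> < 1" and ev: "\<And>t. t \<ge> N \<Longrightarrow> norm ((T ^^ t) x) \<le> c * \<rho> ^ t"
  shows "exp_decay T x"
proof -
  let ?C = "\<bar>c\<bar> + (\<Sum>t<N. norm ((T ^^ t) x) / \<rho> ^ t)"
  have "norm ((T ^^ t) x) \<le> ?C * \<rho> ^ t" for t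
  proof (cases "t < N")
    case True
    then have "norm ((T ^^ t) x) / \<rho> ^ t \<le> (\<Sum>t<N. norm ((T ^^ t) x) / \<rho> ^ t)"
      using \<rho> by (intro member_le_sum) auto
    then have "norm ((T ^^ t) x) / \<rho> ^ t \<le> ?C" by linarith
    then show ?thesis using \<rho> by (simp add: pos_divide_le_eq)
  next
    case False
    have "(\<Sum>t<N. norm ((T ^^ t) x) / \<rho> ^ t) \<ge> 0" using \<rho> by (intro sum_nonneg) simp
    then have "c \<le> ?C" by linarith
    then have "c * \<rho> ^ t \<le> ?C * \<rho> ^ t" using \<rho> by (intro mult_right_mono) auto
    then show ?thesis using ev[of t] False by simp
  qed
  then show ?thesis using \<rho> unfolding exp_decay_def by blast
qed

section \<open>Roots of unity and the inverse of 1 - (T / r)^N\<close>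

definition circ_root :: "nat \<Rightarrow> real \<Rightarrow> nat \<Rightarrow> complex" where
  "circ_root N r k = of_real r * cis (2 * pi * real k / real N)"

lemma norm_circ_root: "r \<ge> 0 \<Longrightarrow> cmod (circ_root N r k) = r"
  by (simp add: circ_root_def norm_mult)

text \<open>Orthogonality of the roots of unity: among the exponents from 1 to \<open>N\<close> only
  \<open>N\<close> itself is a multiple of \<open>N\<close>.\<close>

lemma sum_circ_root_power:
  assumes m: "1 \<le> m" "m \<le> N"
  shows "(\<Sum>k<N. circ_root N r k ^ m) = (if m = N then of_nat N * of_real r ^ N else 0)"
proof -
  let ?w = "cis (2 * pi * real m / real N)"
  have N: "N > 0" using m by simp
  have pow: "circ_root N r k ^ m = of_real r ^ m * ?w ^ k" for k
    by (simp add: circ_root_def power_mult_distrib Complex.DeMoivre mult_ac)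
  have wN: "?w ^ N = 1"
    using N by (simp add: Complex.DeMoivre cis_multiple_2pi)
  show ?thesis
  proof (cases "m = N")
    case True
    then have w1: "?w = 1" using N by simp
    have "(\<Sum>k<N. circ_root N r k ^ m) = of_nat N * of_real r ^ m"
      unfolding pow w1 by simp
    then show ?thesis using True by simp
  next
    case False
    have "?w \<noteq> 1"
    proof
      assume "?w = 1"
      then have "cos (2 * pi * real m / real N) = 1" by (metis cis.simps(1) one_complex.simps(1))
      then obtain i :: int where "2 * pi * real m / real N = of_int i * 2 * pi"
        using cos_one_2pi_int by blast
      then have "real m = of_int i * real N" using N by (simp add: field_simps)
      then have i: "int m = i * int N" by (metis of_int_eq_iff of_int_mult of_int_of_nat_eq)
      have "i > 0" using i m N by (metis of_nat_0_less_iff zero_less_mult_pos2 less_le_trans zero_less_one)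
      moreover have "i < 1"
      proof (rule ccontr)
        assume "\<not> i < 1"
        then have "1 * int N \<le> i * int N" by (intro mult_right_mono) auto
        then have "int N \<le> int m" using i by simp
        then show False using m False by simp
      qed
      ultimately show False by simp
    qed
    then have "(\<Sum>k<N. ?w ^ k) = 0"
      using sum_gp_strict[of ?w N] wN by simp
    then show ?thesis using False by (simp add: pow flip: sum_distrib_left)
  qed
qed

context closed_operator
begin

text \<open>A discrete contour integral over the \<open>N\<close>-th roots u of
  \<open>r ^ N\<close>. It comes from the partial fraction expansion of 1 / (1 - (x / r)^N), whose
  residues give the terms (u / N) / (u - x).\<close>

definition root_mean :: "nat \<Rightarrow> real \<Rightarrow> 'a \<Rightarrow> 'a" where
  "root_mean N r x = (\<Sum>k<N. (circ_root N r k / of_nat N) *\<^sub>C R (circ_root N r k) x)"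

text \<open>This is the factorization of \<open>u ^ N - T ^^ N\<close> by \<open>u - T\<close>. The
  additional factor \<open>u\<close> moves the exponents into the range from 1 to \<open>N\<close>
  required by \<open>sum_circ_root_power\<close>.\<close>

lemma resolvent_power_diff:
  assumes u: "u \<notin> \<sigma>" and x: "x \<in> V"
  shows "u *\<^sub>C R u (u ^ N *\<^sub>C x - (T ^^ N) x) = (\<Sum>j<N. u ^ (N - j) *\<^sub>C (T ^^ j) x)"
proof -
  note Ru = resolvent_bop[OF u]
  define h where "h j = u ^ (N - j) *\<^sub>C (T ^^ j) x" for j
  have h: "u *\<^sub>C R u (h j - h (Suc j)) = h j" if "j < N" for j
  proof -
    have N: "N - j = Suc (N - Suc j)" using that by simp
    have "h j - h (Suc j) = u ^ (N - Suc j) *\<^sub>C (u *\<^sub>C (T ^^ j) x - T ((T ^^ j) x))"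
      unfolding h_def N by (simp add: complex_vector.scale_right_diff_distrib scaleC_scaleC mult.commute)
    then have "R u (h j - h (Suc j)) = u ^ (N - Suc j) *\<^sub>C R u (u *\<^sub>C (T ^^ j) x - T ((T ^^ j) x))"
      by (simp only: bop_scaleC[OF Ru] mem_diff mem_scale T_mem pow_mem x)
    also have "R u (u *\<^sub>C (T ^^ j) x - T ((T ^^ j) x)) = (T ^^ j) x"
      by (intro resolvent_left u pow_mem x)
    finally show ?thesis unfolding h_def N by (simp add: scaleC_scaleC)
  qed
  have m: "h j \<in> V" for j unfolding h_def by (intro mem_scale pow_mem x)
  have "u ^ N *\<^sub>C x - (T ^^ N) x = h 0 - h N" by (simp add: h_def)
  also have "\<dots> = (\<Sum>j<N. h j - h (Suc j))" by (rule sum_lessThan_telescope'[symmetric])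
  finally have "u *\<^sub>C R u (u ^ N *\<^sub>C x - (T ^^ N) x) = (\<Sum>j<N. u *\<^sub>C R u (h j - h (Suc j)))"
    by (simp add: bop_sum[OF Ru] mem_diff m complex_vector.scale_sum_right)
  also have "\<dots> = (\<Sum>j<N. h j)" using h by simp
  finally show ?thesis by (simp add: h_def)
qed

context
  fixes N :: nat and r :: real
  assumes N: "N \<ge> 1" and r: "r > 0" and res: "\<And>z. cmod z = r \<Longrightarrow> z \<notin> \<sigma>"
begin

lemma root_notin: "circ_root N r k \<notin> \<sigma>"
  using res norm_circ_root r by simp

lemma root_mean_bop: "bounded_operator_on V (root_mean N r)"
  unfolding root_mean_def [abs_def]
  by (intro bop_sum_ops sub bop_comp[OF scaleC_bop resolvent_bop] root_notin) simp

text \<open>Summing \<open>resolvent_power_diff\<close> over all roots leaves only the term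
  \<open>j = 0\<close>, by orthogonality.\<close>

lemma root_mean_left:
  assumes x: "x \<in> V"
  shows "root_mean N r (x - inverse (r ^ N) *\<^sub>R (T ^^ N) x) = x"
proof -
  let ?u = "circ_root N r"
  \<comment> \<open>All nodes have the same \<open>N\<close>-th power, so the argument of
    \<open>root_mean\<close> can be rewritten separately at each node.\<close>
  have u: "?u k ^ N = of_real r ^ N" for k
    using N by (simp add: circ_root_def power_mult_distrib Complex.DeMoivre cis_multiple_2pi)
  have "root_mean N r (of_real r ^ N *\<^sub>C x - (T ^^ N) x) =
      (\<Sum>k<N. (1 / of_nat N) *\<^sub>C ?u k *\<^sub>C R (?u k) (?u k ^ N *\<^sub>C x - (T ^^ N) x))"
    unfolding root_mean_def u by (simp add: scaleC_scaleC)
  also have "\<dots> = (1 / of_nat N) *\<^sub>C (\<Sum>k<N. \<Sum>j<N. ?u k ^ (N - j) *\<^sub>C (T ^^ j) x)"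
    by (simp add: resolvent_power_diff[OF root_notin x] complex_vector.scale_sum_right)
  also have "(\<Sum>k<N. \<Sum>j<N. ?u k ^ (N - j) *\<^sub>C (T ^^ j) x) = (\<Sum>j<N. (\<Sum>k<N. ?u k ^ (N - j)) *\<^sub>C (T ^^ j) x)"
    by (subst sum.swap) (simp add: complex_vector.scale_sum_left)
  also have "\<dots> = (\<Sum>j<N. if j = 0 then (of_nat N * of_real r ^ N) *\<^sub>C x else 0)"
    by (intro sum.cong refl) (auto simp: sum_circ_root_power)
  also have "\<dots> = (of_nat N * of_real r ^ N) *\<^sub>C x" using N by simp
  finally have *: "root_mean N r (of_real r ^ N *\<^sub>C x - (T ^^ N) x) = of_real r ^ N *\<^sub>C x"
    using N by (simp add: scaleC_scaleC)
  have rN: "complex_of_real (r ^ N) \<noteq> 0" using r by simp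
  have "x - inverse (r ^ N) *\<^sub>R (T ^^ N) x = inverse (of_real (r ^ N)) *\<^sub>C (of_real r ^ N *\<^sub>C x - (T ^^ N) x)"
    using rN by (simp add: complex_vector.scale_right_diff_distrib scaleC_scaleC flip: scaleC_of_real)
  then have "root_mean N r (x - inverse (r ^ N) *\<^sub>R (T ^^ N) x) =
      inverse (of_real (r ^ N)) *\<^sub>C (of_real r ^ N *\<^sub>C x)"
    using * bop_scaleC[OF root_mean_bop] x by (simp add: mem_diff mem_scale pow_mem)
  then show ?thesis using rN by (simp add: scaleC_scaleC)
qed

lemma root_mean_right:
  assumes x: "x \<in> V"
  shows "root_mean N r x - inverse (r ^ N) *\<^sub>R (T ^^ N) (root_mean N r x) = x"
proof -
  have c: "(T ^^ N) (root_mean N r x) = root_mean N r ((T ^^ N) x)"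
  proof -
    have TN: "(T ^^ N) (T y) = T ((T ^^ N) y)" for y by (simp add: funpow_swap1)
    show ?thesis
      unfolding root_mean_def
      by (simp add: pow_sum pow_scale mem_scale resolvent_mem[OF root_notin] x
          resolvent_commute[OF root_notin pow_bop TN])
  qed
  show ?thesis
    using root_mean_left[OF x] x
    by (simp add: c bop_diff[OF root_mean_bop] bop_scaleR[OF root_mean_bop] mem_scaleR pow_mem)
qed

end

text \<open>Nodes with the same index at the radii \<open>a\<close> and \<open>b\<close> have
  distance \<open>\<bar>a - b\<bar>\<close>, and the resolvent identity turns this into an estimate
  for each term. The weights 1 / N cancel the number of nodes, so the constant is independent of
  \<open>N\<close>.\<close>

lemma root_mean_lipschitz:
  assumes N: "N \<ge> 1" and \<rho>: "\<rho> > 0" "\<rho> \<le> a" "\<rho> \<le> b" "b \<le> K" and M: "M \<ge> 0"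
    and res: "\<And>z. cmod z \<ge> \<rho> \<Longrightarrow> z \<notin> \<sigma>"
    and bound: "\<And>z x. cmod z \<ge> \<rho> \<Longrightarrow> x \<in> V \<Longrightarrow> norm (R z x) \<le> M * norm x" and x: "x \<in> V"
  shows "norm (root_mean N a x - root_mean N b x) \<le> \<bar>a - b\<bar> * (M + K * M\<^sup>2) * norm x"
proof -
  let ?c = "\<bar>a - b\<bar> * (M + K * M\<^sup>2) * norm x"
  have "norm ((circ_root N a k / of_nat N) *\<^sub>C R (circ_root N a k) x -
        (circ_root N b k / of_nat N) *\<^sub>C R (circ_root N b k) x) \<le> ?c / real N" for k
  proof -
    let ?u = "circ_root N a k" and ?v = "circ_root N b k"
    have nu: "cmod ?u \<ge> \<rho>" and nv: "cmod ?v \<ge> \<rho>" and nvK: "cmod ?v \<le> K" using \<rho> by (simp_all add: norm_circ_root)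
    have uv: "cmod (?u - ?v) = \<bar>a - b\<bar>"
      by (simp add: circ_root_def norm_mult flip: left_diff_distrib of_real_diff)
    have eq: "?u *\<^sub>C R ?u x - ?v *\<^sub>C R ?v x = (?u - ?v) *\<^sub>C R ?u x + ?v *\<^sub>C ((?v - ?u) *\<^sub>C R ?u (R ?v x))"
      unfolding resolvent_identity[OF res[OF nu] res[OF nv] x, symmetric]
      by (simp add: complex_vector.scale_right_diff_distrib complex_vector.scale_left_diff_distrib)
    have 1: "norm (R ?u x) \<le> M * norm x" using bound[OF nu x] .
    have 2: "norm (R ?u (R ?v x)) \<le> M * (M * norm x)"
      using bound[OF nu resolvent_mem[OF res[OF nv] x]] mult_left_mono[OF bound[OF nv x] M] by linarith
    have "norm (?u *\<^sub>C R ?u x - ?v *\<^sub>C R ?v x) \<le>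
        \<bar>a - b\<bar> * norm (R ?u x) + cmod ?v * (\<bar>a - b\<bar> * norm (R ?u (R ?v x)))"
      unfolding eq by (rule norm_triangle_le) (simp add: norm_scaleC norm_mult uv norm_minus_commute[of ?v])
    also have "\<dots> \<le> \<bar>a - b\<bar> * (M * norm x) + K * (\<bar>a - b\<bar> * (M * (M * norm x)))"
      using 1 2 nvK \<rho> M by (intro add_mono mult_left_mono mult_mono) auto
    also have "\<dots> = ?c" by (simp add: algebra_simps power2_eq_square)
    finally have "norm (?u *\<^sub>C R ?u x - ?v *\<^sub>C R ?v x) \<le> ?c" .
    moreover have "(?u / of_nat N) *\<^sub>C R ?u x - (?v / of_nat N) *\<^sub>C R ?v x =
        (1 / of_nat N) *\<^sub>C (?u *\<^sub>C R ?u x - ?v *\<^sub>C R ?v x)"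
      by (simp add: complex_vector.scale_right_diff_distrib scaleC_scaleC)
    ultimately show ?thesis
      by (simp add: norm_scaleC norm_divide divide_right_mono)
  qed
  then have "norm (root_mean N a x - root_mean N b x) \<le> (\<Sum>k<N. ?c / real N)"
    unfolding root_mean_def sum_subtractf[symmetric] by (intro sum_norm_le)
  then show ?thesis using N by simp
qed

text \<open>This is Rickart's elementary route to the spectral radius formula: \<open>root_mean N r\<close> inverts
  \<open>1 - (T / r)\<^sup>N\<close> and is Lipschitz in \<open>r\<close> uniformly in \<open>N\<close>, so that smallness of \<open>(T / r)\<^sup>N\<close>
  propagates to smaller radii in steps of a fixed size.\<close>

lemma power_bound_step:
  assumes \<rho>: "0 < \<rho>" "\<rho> \<le> r" "r + \<delta> \<le> K" and M: "M \<ge> 0"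
    and res: "\<And>z. cmod z \<ge> \<rho> \<Longrightarrow> z \<notin> \<sigma>"
    and bound: "\<And>z x. cmod z \<ge> \<rho> \<Longrightarrow> x \<in> V \<Longrightarrow> norm (R z x) \<le> M * norm x"
    and \<delta>: "\<delta> > 0" "8 * \<delta> * (M + K * M\<^sup>2) \<le> 1"
    and N: "N \<ge> 1" "(r / (r + \<delta>)) ^ N \<le> 1/5"
    and pow: "\<And>x. x \<in> V \<Longrightarrow> norm ((T ^^ N) x) \<le> r ^ N * norm x" and x: "x \<in> V"
  shows "norm ((T ^^ N) x) \<le> max \<rho> (r - \<delta>) ^ N * norm x"
proof -
  \<comment> \<open>The bound is wanted at the inner radius \<open>a\<close>. At the outer radius
    \<open>b\<close> the operator (T / b)^N has norm at most 1/5 by the bound already known at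
    \<open>r\<close>.\<close>
  define a b where "a = max \<rho> (r - \<delta>)" and "b = r + \<delta>"
  have ab: "\<rho> \<le> a" "\<rho> \<le> b" "b \<le> K" "\<bar>a - b\<bar> \<le> 2 * \<delta>" "a > 0" "b > 0" "r > 0"
    using \<rho> \<delta> by (auto simp: a_def b_def)
  \<comment> \<open>Then \<open>x\<close> and \<open>y\<close> are the root means of
    \<open>z\<close> at the radii \<open>a\<close> and \<open>b\<close>. Here \<open>y\<close> is
    close to \<open>z\<close> because (T / b)^N is small, and \<open>x\<close> is close to
    \<open>y\<close> by the Lipschitz estimate.\<close>
  define z where "z = x - inverse (a ^ N) *\<^sub>R (T ^^ N) x"
  define y where "y = root_mean N b z"
  have zV: "z \<in> V" unfolding z_def by (intro mem_diff mem_scaleR pow_mem x)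
  have res': "w \<notin> \<sigma>" if "cmod w = a \<or> cmod w = b" for w using res ab that by auto
  have xz: "root_mean N a z = x"
    unfolding z_def by (rule root_mean_left[OF N(1) ab(5) _ x]) (use res' in blast)
  have yz: "y - inverse (b ^ N) *\<^sub>R (T ^^ N) y = z"
    unfolding y_def by (rule root_mean_right[OF N(1) ab(6) _ zV]) (use res' in blast)
  have yV: "y \<in> V"
    unfolding y_def by (rule bop_mem[OF root_mean_bop[OF N(1) ab(6)] zV]) (use res' in blast)
  have "norm (y - z) = norm ((T ^^ N) y) / b ^ N"
    using ab by (simp add: divide_inverse flip: yz)
  also have "\<dots> \<le> (r ^ N * norm y) / b ^ N"
    using pow[OF yV] ab by (intro divide_right_mono) auto
  also have "\<dots> = (r / b) ^ N * norm y" by (simp add: power_divide)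
  also have "\<dots> \<le> 1/5 * norm y" using N(2) unfolding b_def by (intro mult_right_mono) auto
  finally have "norm (y - z) \<le> 1/5 * norm y" .
  moreover have "norm y \<le> norm z + norm (y - z)" by (rule norm_triangle_sub)
  ultimately have 1: "norm (y - z) \<le> 1/4 * norm z" by linarith
  have "norm (x - y) \<le> \<bar>a - b\<bar> * (M + K * M\<^sup>2) * norm z"
    unfolding xz[symmetric] y_def by (rule root_mean_lipschitz[OF N(1) \<rho>(1) ab(1-3) M res bound zV])
  also have "\<dots> \<le> 1/4 * norm z"
  proof (rule mult_right_mono)
    have "K \<ge> 0" using ab by linarith
    then have "\<bar>a - b\<bar> * (M + K * M\<^sup>2) \<le> 2 * \<delta> * (M + K * M\<^sup>2)"
      using ab(4) M by (intro mult_right_mono) auto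
    then show "\<bar>a - b\<bar> * (M + K * M\<^sup>2) \<le> 1/4" using \<delta>(2) by (simp add: algebra_simps)
  qed simp
  finally have 2: "norm (x - y) \<le> 1/4 * norm z" .
  have "norm (x - z) \<le> norm (x - y) + norm (y - z)"
    using norm_triangle_ineq[of "x - y" "y - z"] by simp
  moreover have "norm z \<le> norm x + norm (x - z)"
    using norm_triangle_sub[of z x] by (simp add: norm_minus_commute)
  \<comment> \<open>Two errors of at most a quarter of \<open>norm z\<close> give
    \<open>norm (x - z) \<le> norm z / 2\<close>, while
    \<open>norm z \<le> norm x + norm (x - z)\<close>. This is the reason for 1/5 and for the factor
    8 in the assumptions.\<close>
  ultimately have "norm (x - z) \<le> norm x" using 1 2 by linarith
  moreover have "norm (x - z) = norm ((T ^^ N) x) / a ^ N"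
    using ab by (simp add: z_def divide_inverse)
  ultimately show ?thesis using ab by (simp add: a_def pos_divide_le_eq mult.commute)
qed

text \<open>The step size \<open>\<delta>\<close> depends only on \<open>K\<close> and
  \<open>M\<close>, so finitely many steps lead from the radius \<open>K\<close>, where the bound is
  clear, down to \<open>\<rho>\<close>. Only the exponent from which the bound holds may grow on the
  way.\<close>

lemma power_bound:
  assumes \<rho>: "0 < \<rho>" and M: "M \<ge> 0"
    and res: "\<And>z. cmod z \<ge> \<rho> \<Longrightarrow> z \<notin> \<sigma>"
    and bound: "\<And>z x. cmod z \<ge> \<rho> \<Longrightarrow> x \<in> V \<Longrightarrow> norm (R z x) \<le> M * norm x"
  shows "\<exists>n. \<forall>N\<ge>n. \<forall>x\<in>V. norm ((T ^^ N) x) \<le> \<rho> ^ N * norm x"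
proof -
  define D where "D r \<longleftrightarrow> (\<exists>n. \<forall>N\<ge>n. \<forall>x\<in>V. norm ((T ^^ N) x) \<le> r ^ N * norm x)" for r
  obtain K0 where K0: "K0 \<ge> 0" "\<And>x. x \<in> V \<Longrightarrow> norm (T x) \<le> K0 * norm x"
    using bop_bound[OF bop] by blast
  define K where "K = K0 + \<rho>"
  have K: "K \<ge> \<rho>" "\<And>x. x \<in> V \<Longrightarrow> norm (T x) \<le> K * norm x"
    using K0 \<rho> by (auto simp: K_def algebra_simps intro: order_trans[OF K0(2)] add_increasing2)
  \<comment> \<open>The outer radius \<open>r + \<delta>\<close> is at most \<open>K + 1\<close>,
    since the final summand 1 forces \<open>L \<ge> 1\<close> and hence
    \<open>\<delta> \<le> 1\<close>.\<close>
  define L where "L = M + (K + 1) * M\<^sup>2 + 1"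
  define \<delta> where "\<delta> = 1 / (8 * L)"
  have L: "L \<ge> 1" using M K \<rho> by (simp add: L_def)
  have \<delta>: "\<delta> > 0" "\<delta> \<le> 1" using L by (auto simp: \<delta>_def field_simps)
  have \<delta>L: "8 * \<delta> * (M + (K + 1) * M\<^sup>2) \<le> 1"
    using L by (simp add: \<delta>_def pos_divide_le_eq) (simp add: L_def)
  have step: "D (max \<rho> (r - \<delta>))" if D: "D r" and r: "\<rho> \<le> r" "r \<le> K" for r
  proof -
    obtain n where n: "\<And>N x. N \<ge> n \<Longrightarrow> x \<in> V \<Longrightarrow> norm ((T ^^ N) x) \<le> r ^ N * norm x"
      using D unfolding D_def by blast
    have q: "0 \<le> r / (r + \<delta>)" "r / (r + \<delta>) < 1" using r \<rho> \<delta> by auto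
    obtain m where m: "(r / (r + \<delta>)) ^ m < 1/5"
      using real_arch_pow_inv[OF _ q(2), of "1/5"] by auto
    have "norm ((T ^^ N) x) \<le> max \<rho> (r - \<delta>) ^ N * norm x" if "N \<ge> n + m + 1" "x \<in> V" for N x
    proof (rule power_bound_step[OF \<rho> r(1) _ M res bound \<delta>(1) \<delta>L])
      show "r + \<delta> \<le> K + 1" using r \<delta> by simp
      have "(r / (r + \<delta>)) ^ N \<le> (r / (r + \<delta>)) ^ m"
        using that q by (intro power_decreasing) auto
      then show "(r / (r + \<delta>)) ^ N \<le> 1/5" using m by simp
    qed (use that n in auto)
    then show ?thesis unfolding D_def by blast
  qed
  have "D (max \<rho> (K - real i * \<delta>))" for i
  proof (induction i)
    case 0
    have "D K"
      unfolding D_def using bop_funpow_norm[OF bop _ K(2)] K(1) \<rho> by auto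
    then show ?case using K by (simp add: max_absorb2)
  next
    case (Suc i)
    have "max \<rho> (K - real i * \<delta>) \<le> K" using K \<delta> by simp
    from step[OF Suc _ this] have "D (max \<rho> (max \<rho> (K - real i * \<delta>) - \<delta>))" by simp
    also have "max \<rho> (max \<rho> (K - real i * \<delta>) - \<delta>) = max \<rho> (K - real (Suc i) * \<delta>)"
      using \<delta> by (auto simp: max_def algebra_simps)
    finally show ?case .
  qed
  moreover obtain i where "K / \<delta> < real i" using reals_Archimedean2 by blast
  then have "K - real i * \<delta> < 0" using \<delta> by (simp add: pos_divide_less_eq)
  then have "max \<rho> (K - real i * \<delta>) = \<rho>" using \<rho> by simp
  ultimately show ?thesis unfolding D_def by metis
qed

text \<open>A compact annulus together with \<open>resolvent_outside\<close> gives one resolvent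
  bound \<open>M\<close> for all \<open>z\<close> of modulus at least 1. Perturbation carries it to
  a radius below 1, and \<open>power_bound\<close> applies there.\<close>

lemma exp_decay_if_spectrum_in_disc:
  assumes spec: "\<And>z. z \<in> \<sigma> \<Longrightarrow> cmod z < 1" and x: "x \<in> V"
  shows "exp_decay T x"
proof -
  obtain K where K: "K \<ge> 0" "\<And>x. x \<in> V \<Longrightarrow> norm (T x) \<le> K * norm x"
    using bop_bound[OF bop] by blast
  have "compact (cball 0 (2 * K + 2) - ball (0::complex) 1)"
    by (intro compact_diff) auto
  then obtain M0 where M0: "\<And>z x. z \<in> cball 0 (2 * K + 2) - ball 0 1 \<Longrightarrow> x \<in> V \<Longrightarrow> norm (R z x) \<le> M0 * norm x"
    by (rule resolvent_bounded_on_compact) (use spec in auto)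
  define M where "M = max M0 1"
  have M: "norm (R z x) \<le> M * norm x" if z: "cmod z \<ge> 1" and x: "x \<in> V" for z x
  proof (cases "cmod z \<ge> 2 * K + 2")
    case True
    have "norm x \<le> M * norm x"
      using mult_right_mono[of 1 M "norm x"] by (simp add: M_def)
    then show ?thesis using resolvent_outside(2)[OF K True x] by linarith
  next
    case False
    then have "norm (R z x) \<le> M0 * norm x" using M0[of z x] z x by simp
    also have "\<dots> \<le> M * norm x" by (intro mult_right_mono) (auto simp: M_def)
    finally show ?thesis .
  qed
  have M1: "M \<ge> 1" by (simp add: M_def)
  \<comment> \<open>A point of modulus between \<open>\<rho>\<close> and 1 has distance at most 1 /
    (2 M) from its projection \<open>sgn z\<close> to the unit circle, the reach of
    \<open>not_in_spectrum_perturb\<close>. From \<open>M \<ge> 1\<close> follows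
    \<open>\<rho> > 0\<close>.\<close>
  define \<rho> where "\<rho> = 1 - 1 / (2 * M)"
  have \<rho>: "0 < \<rho>" "\<rho> < 1" using M1 by (auto simp: \<rho>_def field_simps)
  have near: "z \<notin> \<sigma> \<and> (\<forall>x\<in>V. norm (R z x) \<le> 2 * M * norm x)" if z: "cmod z \<ge> \<rho>" for z
  proof (cases "cmod z \<ge> 1")
    case True
    have "norm (R z x) \<le> 2 * M * norm x" if x: "x \<in> V" for x
    proof -
      have "0 \<le> M * norm x" using M1 by simp
      then show ?thesis using M[OF True x] by linarith
    qed
    then show ?thesis using True spec by force
  next
    case False
    have z0: "z \<noteq> 0" using z \<rho> by auto
    let ?w = "sgn z"
    have w: "cmod ?w = 1" using z0 by (simp add: norm_sgn)
    have "cmod (z - ?w) = 1 - cmod z"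
    proof -
      have "z - ?w = of_real (cmod z - 1) * ?w"
        using z0 by (simp add: sgn_div_norm scaleR_conv_of_real field_simps)
      then show ?thesis using False w by (simp add: norm_mult del: of_real_diff)
    qed
    also have "\<dots> \<le> 1 / (2 * M)" using z by (simp add: \<rho>_def)
    finally have "cmod (z - ?w) * M \<le> 1 / (2 * M) * M"
      using M1 by (intro mult_right_mono) auto
    then have d: "cmod (z - ?w) * M \<le> 1/2" using M1 by simp
    have ws: "?w \<notin> \<sigma>" using spec w by force
    show ?thesis
      using not_in_spectrum_perturb[OF ws _ M[of ?w] d] w M1 by simp
  qed
  have "\<exists>n. \<forall>N\<ge>n. \<forall>x\<in>V. norm ((T ^^ N) x) \<le> \<rho> ^ N * norm x"
    by (rule power_bound[OF \<rho>(1), of "2 * M"]) (use near M1 in auto)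
  then obtain n where "\<And>N x. N \<ge> n \<Longrightarrow> x \<in> V \<Longrightarrow> norm ((T ^^ N) x) \<le> \<rho> ^ N * norm x"
    by blast
  then show ?thesis
    using exp_decayI_eventually[OF \<rho>, of n T x "norm x"] x by (simp add: mult.commute)
qed

section \<open>Removing the spectral points outside the open unit disc one by one\<close>

lemma restrict_finite_multiplicity:
  assumes "finite_algebraic_multiplicity V T z" "closed_operator W T" "W \<subseteq> V" "spectrum_on W T \<subseteq> \<sigma>"
    and res: "\<And>z x. z \<notin> \<sigma> \<Longrightarrow> x \<in> W \<Longrightarrow> resolvent_on W T z x = R z x"
  shows "finite_algebraic_multiplicity W T z"
proof -
  interpret W: closed_operator W T by fact
  obtain r where r: "r > 0" "cball z r \<inter> \<sigma> \<subseteq> {z}" "finite_dim (spectral_projection V T z r ` V)"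
    using assms(1) unfolding finite_algebraic_multiplicity_def by blast
  have circle: "sphere z r \<inter> \<sigma> = {}" using r(1,2) by (auto simp: subset_iff)
  have "spectral_projection W T z r x = spectral_projection V T z r x" if "x \<in> W" for x
    unfolding spectral_projection_moment W.spectral_projection_moment moment_def W.moment_def
    using res[OF circle_notin[OF r(1) circle] that] by simp
  then have "spectral_projection W T z r ` W \<subseteq> spectral_projection V T z r ` V"
    using assms(3) by force
  then show ?thesis
    using r assms(4) finite_dim_subset unfolding finite_algebraic_multiplicity_def by blast
qed

end

lemma finite_dim_sums:
  assumes "finite_dim S" "finite_dim W"
  shows "finite_dim {x + y | x y. x \<in> S \<and> y \<in> W}"
proof -
  obtain A B where A: "finite A" "S \<subseteq> complex_vector.span A" and B: "finite B" "W \<subseteq> complex_vector.span B"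
    using assms unfolding finite_dim_def by blast
  have "x + y \<in> complex_vector.span (A \<union> B)" if "x \<in> S" "y \<in> W" for x y
  proof (rule complex_vector.span_add)
    show "x \<in> complex_vector.span (A \<union> B)"
      using that A complex_vector.span_mono[of A "A \<union> B"] by blast
    show "y \<in> complex_vector.span (A \<union> B)"
      using that B complex_vector.span_mono[of B "A \<union> B"] by blast
  qed
  then show ?thesis
    unfolding finite_dim_def using A B by (intro exI[of _ "A \<union> B"]) auto
qed

text \<open>Each step of the induction passes from \<open>V\<close> to the subspace \<open>W\<close>
  split off at \<open>l\<close>, whose spectrum omits \<open>l\<close>; hence \<open>V\<close> and
  \<open>x\<close> vary. The hypothesis asks for finite multiplicity because this passes to
  \<open>W\<close>. As \<Lambda> is only a superset of the dangerous points, \<open>l\<close> may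
  also be harmless.\<close>

lemma finite_dim_plus_decay:
  fixes V :: "'a::complex_banach set"
  assumes "finite \<Lambda>" "closed_operator V T"
    and "\<And>z. z \<in> spectrum_on V T \<Longrightarrow> cmod z \<ge> 1 \<Longrightarrow> z \<in> \<Lambda> \<and> finite_algebraic_multiplicity V T z"
    and "x \<in> V"
  shows "\<exists>E e w. complex_vector.subspace E \<and> E \<subseteq> V \<and> finite_dim E \<and> (\<forall>y\<in>E. T y \<in> E) \<and>
    e \<in> E \<and> w \<in> V \<and> exp_decay T w \<and> x = e + w"
  using assms
proof (induction \<Lambda> arbitrary: V x rule: finite_induct)
  case empty
  interpret closed_operator V T by fact
  have "exp_decay T x"
    by (rule exp_decay_if_spectrum_in_disc[OF _ empty(3)]) (use empty(2) in force)
  then show ?case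
    using empty(3) mem_zero T_zero
    by (intro exI[of _ "{0}"] exI[of _ 0] exI[of _ x]) (auto simp: finite_dim_def)
next
  case (insert l \<Lambda>)
  interpret closed_operator V T by fact
  show ?case
  proof (cases "l \<in> \<sigma> \<and> cmod l \<ge> 1")
    case False
    then show ?thesis
      using insert.IH[OF insert.prems(1) _ insert.prems(3)] insert.prems(2) by blast
  next
    case True
    then have "finite_algebraic_multiplicity V T l" using insert.prems by blast
    then obtain r where r: "r > 0" "cball l r \<inter> \<sigma> \<subseteq> {l}"
        "finite_dim (spectral_projection V T l r ` V)"
      unfolding finite_algebraic_multiplicity_def by blast
    obtain E W where E: "complex_vector.subspace E" "E \<subseteq> V" "finite_dim E" "\<And>x. x \<in> E \<Longrightarrow> T x \<in> E"
      and W: "W \<subseteq> V" "closed_operator W T" "spectrum_on W T \<subseteq> \<sigma> - {l}"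
        "\<And>z x. z \<notin> \<sigma> \<Longrightarrow> x \<in> W \<Longrightarrow> resolvent_on W T z x = R z x"
      and split: "\<And>x. x \<in> V \<Longrightarrow> \<exists>e\<in>E. \<exists>w\<in>W. x = e + w"
      using split_spectral_point[OF r] by blast
    obtain e0 w0 where 0: "e0 \<in> E" "w0 \<in> W" "x = e0 + w0"
      using split[OF insert.prems(3)] by blast
    have "\<exists>F e w. complex_vector.subspace F \<and> F \<subseteq> W \<and> finite_dim F \<and> (\<forall>y\<in>F. T y \<in> F) \<and>
        e \<in> F \<and> w \<in> W \<and> exp_decay T w \<and> w0 = e + w"
    proof (rule insert.IH[OF W(2) _ 0(2)])
      fix z assume z: "z \<in> spectrum_on W T" "cmod z \<ge> 1"
      then have "z \<in> \<Lambda>" "finite_algebraic_multiplicity V T z" using insert.prems(2) W(3) by blast+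
      then show "z \<in> \<Lambda> \<and> finite_algebraic_multiplicity W T z"
        using restrict_finite_multiplicity[OF _ W(2,1) _ W(4)] W(3) by blast
    qed
    then obtain F e w where F: "complex_vector.subspace F" "F \<subseteq> W" "finite_dim F" "\<And>y. y \<in> F \<Longrightarrow> T y \<in> F"
        "e \<in> F" "w \<in> W" "exp_decay T w" "w0 = e + w"
      by blast
    show ?thesis
    proof (intro exI conjI ballI)
      let ?G = "{x + y | x y. x \<in> E \<and> y \<in> F}"
      show "complex_vector.subspace ?G" using complex_vector.subspace_sums[OF E(1) F(1)] .
      show "?G \<subseteq> V" using E(2) F(2) W(1) mem_add by blast
      show "finite_dim ?G" using finite_dim_sums[OF E(3) F(3)] .
      show "e0 + e \<in> ?G" using 0 F by blast
      show "T y \<in> ?G" if y: "y \<in> ?G" for y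
      proof -
        obtain a b where ab: "a \<in> E" "b \<in> F" "y = a + b" using y by blast
        then have "T y = T a + T b" using T_add[of a b] E(2) F(2) W(1) by blast
        then show ?thesis using ab E(4) F(4) by blast
      qed
      show "w \<in> V" "exp_decay T w" "x = (e0 + e) + w" using F W 0 by auto
    qed
  qed
qed

section \<open>Orbits of sublinear growth\<close>

text \<open>A Jordan block of size two at a unimodular eigenvalue grows exactly linearly and is just
  excluded. The value at \<open>t = 0\<close> is a division by zero and does not affect the
  limit.\<close>

definition sublinear :: "('a::complex_normed_vector \<Rightarrow> 'a) \<Rightarrow> 'a \<Rightarrow> bool" where
  "sublinear T x \<longleftrightarrow> (\<lambda>t. norm ((T ^^ t) x) / real t) \<longlonglongrightarrow> 0"

lemma sublinear_le:
  assumes "sublinear T x" "\<And>t. norm ((T ^^ t) y) \<le> K * norm ((T ^^ t) x)"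
  shows "sublinear T y"
proof -
  have "(\<lambda>t. K * (norm ((T ^^ t) x) / real t)) \<longlonglongrightarrow> 0"
    using tendsto_mult_left[OF assms(1)[unfolded sublinear_def], of K] by simp
  then show ?thesis
    unfolding sublinear_def
  proof (rule Lim_null_comparison[rotated])
    show "\<forall>\<^sub>F t in sequentially. norm (norm ((T ^^ t) y) / real t) \<le> K * (norm ((T ^^ t) x) / real t)"
      using assms(2) by (intro always_eventually allI) (simp add: divide_right_mono)
  qed
qed

lemma sublinear_if_bounded:
  assumes "\<And>t. norm ((T ^^ t) x) \<le> C"
  shows "sublinear T x"
proof -
  have "(\<lambda>t. C * inverse (real t)) \<longlonglongrightarrow> 0"
    using tendsto_mult_left[OF lim_inverse_n[where 'a = real], of C] by simp
  then show ?thesis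
    unfolding sublinear_def
  proof (rule Lim_null_comparison[rotated])
    show "\<forall>\<^sub>F t in sequentially. norm (norm ((T ^^ t) x) / real t) \<le> C * inverse (real t)"
      using assms by (intro always_eventually allI) (simp add: divide_inverse mult_right_mono)
  qed
qed

lemma exp_decay_bounded:
  assumes "exp_decay T x"
  obtains C where "\<And>t. norm ((T ^^ t) x) \<le> C"
proof -
  obtain C \<rho> where C: "0 < \<rho>" "\<rho> < 1" "\<And>t. norm ((T ^^ t) x) \<le> C * \<rho> ^ t"
    using assms unfolding exp_decay_def by blast
  have "norm ((T ^^ t) x) \<le> \<bar>C\<bar>" for t
  proof -
    have "norm ((T ^^ t) x) \<le> \<bar>C\<bar> * \<rho> ^ t"
      using C(1) by (intro order_trans[OF C(3)] mult_right_mono) auto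
    also have "\<dots> \<le> \<bar>C\<bar> * 1"
      using C by (intro mult_left_mono) (auto simp: power_le_one)
    finally show ?thesis by simp
  qed
  then show ?thesis by (rule that)
qed

lemma exp_decay_tendsto:
  assumes "exp_decay T x"
  shows "(\<lambda>t. (T ^^ t) x) \<longlonglongrightarrow> 0"
proof -
  obtain C \<rho> where C: "0 < \<rho>" "\<rho> < 1" "\<And>t. norm ((T ^^ t) x) \<le> C * \<rho> ^ t"
    using assms unfolding exp_decay_def by blast
  have "(\<lambda>t. C * \<rho> ^ t) \<longlonglongrightarrow> 0"
    using tendsto_mult_left[OF LIMSEQ_realpow_zero[of \<rho>], of C] C by simp
  then show ?thesis
    by (rule Lim_null_comparison[rotated]) (use C(3) in auto)
qed

lemma eigenvector_funpow:
  assumes T: "bounded_operator_on V T" and y: "y \<in> V" "T y = \<mu> *\<^sub>C y"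
  shows "(T ^^ t) y = \<mu> ^ t *\<^sub>C y"
  by (induction t) (simp_all add: bop_scaleC[OF T] y scaleC_scaleC mult.commute)

context closed_operator
begin

lemma sublinear_add:
  assumes "sublinear T x" "sublinear T y" "x \<in> V" "y \<in> V"
  shows "sublinear T (x + y)"
proof -
  have "(\<lambda>t. norm ((T ^^ t) x) / real t + norm ((T ^^ t) y) / real t) \<longlonglongrightarrow> 0"
    using tendsto_add[OF assms(1,2)[unfolded sublinear_def]] by simp
  then show ?thesis
    unfolding sublinear_def
    by (rule Lim_null_comparison[rotated])
      (auto simp: pow_add assms add_divide_distrib[symmetric] intro!: always_eventually divide_right_mono norm_triangle_ineq)
qed

lemma sublinear_scale: "sublinear T x \<Longrightarrow> x \<in> V \<Longrightarrow> sublinear T (a *\<^sub>C x)"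
  by (rule sublinear_le[of T x _ "cmod a"]) (auto simp: pow_scale norm_scaleC)

lemma sublinear_diff:
  assumes "sublinear T x" "sublinear T y" "x \<in> V" "y \<in> V"
  shows "sublinear T (x - y)"
  using sublinear_add[OF assms(1) sublinear_scale[OF assms(2,4), of "-1"] assms(3) mem_scale[OF assms(4)]]
  by simp

lemma sublinear_T:
  assumes "sublinear T x" "x \<in> V"
  shows "sublinear T (T x)"
proof -
  obtain K where K: "K \<ge> 0" "\<And>x. x \<in> V \<Longrightarrow> norm (T x) \<le> K * norm x"
    using bop_bound[OF bop] by blast
  show ?thesis
    by (rule sublinear_le[OF assms(1), of _ K])
      (simp add: funpow_swap1[symmetric] K(2) pow_mem assms(2))
qed

lemma exp_decay_add:
  assumes "exp_decay T x" "exp_decay T y" "x \<in> V" "y \<in> V"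
  shows "exp_decay T (x + y)"
proof -
  obtain C \<rho> where C: "0 < \<rho>" "\<rho> < 1" "\<And>t. norm ((T ^^ t) x) \<le> C * \<rho> ^ t"
    using assms unfolding exp_decay_def by blast
  obtain D \<tau> where D: "0 < \<tau>" "\<tau> < 1" "\<And>t. norm ((T ^^ t) y) \<le> D * \<tau> ^ t"
    using assms unfolding exp_decay_def by blast
  have pos: "C \<ge> 0" "D \<ge> 0"
    using order_trans[OF norm_ge_zero C(3)[of 0]] order_trans[OF norm_ge_zero D(3)[of 0]] by simp_all
  have "norm ((T ^^ t) (x + y)) \<le> (C + D) * max \<rho> \<tau> ^ t" for t
  proof -
    have "norm ((T ^^ t) (x + y)) \<le> C * \<rho> ^ t + D * \<tau> ^ t"
      using norm_triangle_ineq[of "(T ^^ t) x" "(T ^^ t) y"] C(3)[of t] D(3)[of t] assms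
      by (simp add: pow_add)
    also have "\<dots> \<le> C * max \<rho> \<tau> ^ t + D * max \<rho> \<tau> ^ t"
      using C D pos by (intro add_mono mult_left_mono power_mono) auto
    finally show ?thesis by (simp add: distrib_right)
  qed
  then show ?thesis
    unfolding exp_decay_def using C D by (intro exI[of _ "C + D"] exI[of _ "max \<rho> \<tau>"]) auto
qed

lemma exp_decay_scale:
  assumes "exp_decay T x" "x \<in> V"
  shows "exp_decay T (a *\<^sub>C x)"
proof -
  obtain C \<rho> where C: "0 < \<rho>" "\<rho> < 1" "\<And>t. norm ((T ^^ t) x) \<le> C * \<rho> ^ t"
    using assms unfolding exp_decay_def by blast
  have "norm ((T ^^ t) (a *\<^sub>C x)) \<le> (cmod a * C) * \<rho> ^ t" for t
    using mult_left_mono[OF C(3)[of t], of "cmod a"] assms(2)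
    by (simp add: pow_scale norm_scaleC mult.assoc)
  then show ?thesis unfolding exp_decay_def using C by blast
qed

text \<open>The solution is the Neumann series \<open>- (\<Sum>j. T\<^sup>j d / l\<^sup>j\<^sup>+\<^sup>1)\<close>.\<close>

lemma solve_decaying:
  assumes d: "d \<in> V" "\<And>t. norm ((T ^^ t) d) \<le> C * \<rho> ^ t" and \<rho>: "0 < \<rho>" "\<rho> < 1"
    and l: "cmod l \<ge> 1"
  obtains c where "c \<in> V" "T c - l *\<^sub>C c = d" "\<And>t. norm ((T ^^ t) c) \<le> (C / (1 - \<rho>)) * \<rho> ^ t"
proof -
  have C: "C \<ge> 0" using order_trans[OF norm_ge_zero d(2)[of 0]] by simp
  have l0: "l \<noteq> 0" using l by auto
  define a where "a j = inverse l ^ Suc j *\<^sub>C (T ^^ j) d" for j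
  have aV: "a j \<in> V" for j unfolding a_def by (intro mem_scale pow_mem d)
  have a_norm: "norm ((T ^^ t) (a j)) \<le> C * \<rho> ^ t * \<rho> ^ j" for t j
  proof -
    have "norm ((T ^^ t) (a j)) = inverse (cmod l) ^ Suc j * norm ((T ^^ (t + j)) d)"
      unfolding a_def by (simp add: pow_scale pow_mem d norm_scaleC norm_mult norm_power norm_inverse funpow_add del: power_Suc)
    also have "\<dots> \<le> 1 * (C * \<rho> ^ (t + j))"
      using l d(2) by (intro mult_mono) (auto simp: power_le_one inverse_le_1_iff simp del: power_Suc)
    finally show ?thesis by (simp add: power_add mult.assoc)
  qed
  have "summable a"
  proof (rule summable_comparison_test')
    show "summable (\<lambda>j. C * \<rho> ^ j)"
      using \<rho> by (intro summable_mult summable_geometric) auto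
    show "norm (a j) \<le> C * \<rho> ^ j" for j using a_norm[of 0 j] by simp
  qed
  then obtain A where A: "(\<lambda>n. \<Sum>j<n. a j) \<longlonglongrightarrow> A"
    using summable_LIMSEQ by blast
  have sV: "(\<Sum>j<n. a j) \<in> V" for n by (intro mem_sum aV)
  have AV: "A \<in> V" using closed_sequentially[OF closed sV A] .
  have lim: "(\<lambda>n. \<Sum>j<n. (T ^^ t) (a j)) \<longlonglongrightarrow> (T ^^ t) A" for t
    using bop_tendsto[OF pow_bop A _ AV, of t] sV by (simp add: pow_sum aV)
  have "norm ((T ^^ t) A) \<le> (C / (1 - \<rho>)) * \<rho> ^ t" for t
  proof (rule LIMSEQ_le_const2[OF tendsto_norm[OF lim]], intro exI allI impI)
    fix n
    have "norm (\<Sum>j<n. (T ^^ t) (a j)) \<le> (\<Sum>j<n. C * \<rho> ^ t * \<rho> ^ j)"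
      using a_norm by (intro sum_norm_le)
    also have "\<dots> = C * \<rho> ^ t * ((1 - \<rho> ^ n) / (1 - \<rho>))"
      using \<rho> sum_gp_strict[of \<rho> n] by (simp flip: sum_distrib_left)
    also have "\<dots> \<le> C * \<rho> ^ t * (1 / (1 - \<rho>))"
      using \<rho> C by (intro mult_left_mono divide_right_mono) auto
    finally show "norm (\<Sum>j<n. (T ^^ t) (a j)) \<le> (C / (1 - \<rho>)) * \<rho> ^ t" by simp
  qed
  moreover have "T A - l *\<^sub>C A = - d"
  proof (rule LIMSEQ_unique)
    show "(\<lambda>n. (\<Sum>j<n. T (a j)) - l *\<^sub>C (\<Sum>j<n. a j)) \<longlonglongrightarrow> T A - l *\<^sub>C A"
      using lim[of 1] A by (intro tendsto_diff scaleC.tendsto tendsto_const) auto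
    have "l *\<^sub>C a (Suc j) = T (a j)" for j
      unfolding a_def using l0 by (simp add: T_scale pow_mem d scaleC_scaleC)
    then have "(\<Sum>j<n. T (a j)) - l *\<^sub>C (\<Sum>j<n. a j) = (\<Sum>j<n. l *\<^sub>C a (Suc j) - l *\<^sub>C a j)" for n
      by (simp add: complex_vector.scale_sum_right sum_subtractf)
    also have "\<dots> n = l *\<^sub>C a n - l *\<^sub>C a 0" for n by (rule sum_lessThan_telescope)
    also have "\<dots> n = l *\<^sub>C a n - d" for n using l0 by (simp add: a_def scaleC_scaleC)
    finally have eq: "(\<Sum>j<n. T (a j)) - l *\<^sub>C (\<Sum>j<n. a j) = l *\<^sub>C a n - d" for n .
    have "(\<lambda>n. l *\<^sub>C a n - d) \<longlonglongrightarrow> l *\<^sub>C 0 - d"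
      using summable_LIMSEQ_zero[OF \<open>summable a\<close>] by (intro tendsto_diff scaleC.tendsto tendsto_const)
    then show "(\<lambda>n. (\<Sum>j<n. T (a j)) - l *\<^sub>C (\<Sum>j<n. a j)) \<longlonglongrightarrow> - d"
      unfolding eq by simp
  qed
  ultimately show ?thesis
  proof (intro that[of "- A"])
    have neg: "(T ^^ t) (- A) = - (T ^^ t) A" for t
      using pow_scale[OF AV, of t "-1"] by simp
    show "- A \<in> V" using mem_scale[OF AV, of "-1"] by simp
    assume *: "T A - l *\<^sub>C A = - d" and n: "\<And>t. norm ((T ^^ t) A) \<le> (C / (1 - \<rho>)) * \<rho> ^ t"
    show "T (- A) - l *\<^sub>C (- A) = d" using neg[of 1] * by (simp add: diff_eq_eq)
    show "norm ((T ^^ t) (- A)) \<le> (C / (1 - \<rho>)) * \<rho> ^ t" for t using n neg by simp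
  qed
qed

text \<open>The eigenvectors are indexed by their eigenvalues, so each eigenvalue occurs once and
  its component can be singled out; \<open>y \<mu> = 0\<close> is allowed.\<close>

definition unimodular_plus_decay :: "'a \<Rightarrow> bool" where
  "unimodular_plus_decay x \<longleftrightarrow> (\<exists>M y d. finite M \<and>
     (\<forall>\<mu>\<in>M. cmod \<mu> = 1 \<and> y \<mu> \<in> V \<and> T (y \<mu>) = \<mu> *\<^sub>C y \<mu>) \<and>
     d \<in> V \<and> exp_decay T d \<and> x = (\<Sum>\<mu>\<in>M. y \<mu>) + d)"

lemma unimodular_plus_decay_scale:
  assumes "unimodular_plus_decay x"
  shows "unimodular_plus_decay (a *\<^sub>C x)"
proof -
  obtain M y d where "finite M" "\<And>\<mu>. \<mu> \<in> M \<Longrightarrow> cmod \<mu> = 1 \<and> y \<mu> \<in> V \<and> T (y \<mu>) = \<mu> *\<^sub>C y \<mu>"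
      "d \<in> V" "exp_decay T d" "x = (\<Sum>\<mu>\<in>M. y \<mu>) + d"
    using assms unfolding unimodular_plus_decay_def by blast
  then show ?thesis
    unfolding unimodular_plus_decay_def
    by (intro exI[of _ M] exI[of _ "\<lambda>\<mu>. a *\<^sub>C y \<mu>"] exI[of _ "a *\<^sub>C d"])
      (simp add: mem_scale exp_decay_scale scaleC_add_right complex_vector.scale_sum_right T_scale
        scaleC_scaleC mult.commute)
qed

lemma unimodular_plus_decay_add:
  assumes "unimodular_plus_decay x" "w \<in> V" "exp_decay T w"
  shows "unimodular_plus_decay (x + w)"
proof -
  obtain M y d where "finite M" "\<And>\<mu>. \<mu> \<in> M \<Longrightarrow> cmod \<mu> = 1 \<and> y \<mu> \<in> V \<and> T (y \<mu>) = \<mu> *\<^sub>C y \<mu>"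
      "d \<in> V" "exp_decay T d" "x = (\<Sum>\<mu>\<in>M. y \<mu>) + d"
    using assms unfolding unimodular_plus_decay_def by blast
  then show ?thesis
    unfolding unimodular_plus_decay_def using assms(2,3)
    by (intro exI[of _ M] exI[of _ y] exI[of _ "d + w"]) (simp add: mem_add exp_decay_add)
qed

lemma exp_decay_if_contracting:
  assumes x: "x \<in> V" and d: "d \<in> V" "exp_decay T d" and l: "cmod l < 1" and eq: "T x = l *\<^sub>C x + d"
  shows "exp_decay T x"
proof -
  obtain C \<rho> where C: "0 < \<rho>" "\<rho> < 1" "\<And>t. norm ((T ^^ t) d) \<le> C * \<rho> ^ t"
    using d unfolding exp_decay_def by blast
  have C0: "C \<ge> 0" using order_trans[OF norm_ge_zero C(3)[of 0]] by simp
  define \<tau> where "\<tau> = (1 + max \<rho> (cmod l)) / 2"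
  have \<tau>: "0 < \<tau>" "\<tau> < 1" "\<rho> \<le> \<tau>" "cmod l < \<tau>" using C l by (auto simp: \<tau>_def max_def)
  \<comment> \<open>Chosen so that \<open>cmod l * K + C \<le> K * \<tau>\<close>, which closes the
    induction; the rate \<open>\<tau>\<close> lies strictly above \<open>cmod l\<close> to make this
    solvable.\<close>
  define K where "K = norm x + C / (\<tau> - cmod l)"
  have "K * (\<tau> - cmod l) = norm x * (\<tau> - cmod l) + C"
    using \<tau> by (simp add: K_def distrib_right)
  moreover have "norm x * (\<tau> - cmod l) \<ge> 0" "C / (\<tau> - cmod l) \<ge> 0" using \<tau> C0 by simp_all
  ultimately have K: "C \<le> K * (\<tau> - cmod l)" "norm x \<le> K" by (simp_all add: K_def)
  have "norm ((T ^^ t) x) \<le> K * \<tau> ^ t" for t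
  proof (induction t)
    case 0
    then show ?case using K by simp
  next
    case (Suc t)
    have "(T ^^ Suc t) x = l *\<^sub>C (T ^^ t) x + (T ^^ t) d"
      using x d by (simp add: funpow_swap1 eq pow_add mem_scale pow_scale)
    then have "norm ((T ^^ Suc t) x) \<le> cmod l * norm ((T ^^ t) x) + norm ((T ^^ t) d)"
      by (metis norm_scaleC norm_triangle_ineq)
    also have "\<dots> \<le> cmod l * (K * \<tau> ^ t) + C * \<tau> ^ t"
    proof (intro add_mono mult_left_mono Suc)
      have "C * \<rho> ^ t \<le> C * \<tau> ^ t" using \<tau> C C0 by (intro mult_left_mono power_mono) auto
      then show "norm ((T ^^ t) d) \<le> C * \<tau> ^ t" using C(3)[of t] by linarith
    qed simp
    also have "\<dots> \<le> cmod l * (K * \<tau> ^ t) + K * (\<tau> - cmod l) * \<tau> ^ t"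
      using K \<tau> by (intro add_left_mono mult_right_mono) auto
    also have "\<dots> = K * \<tau> ^ Suc t" by (simp add: algebra_simps)
    finally show ?case .
  qed
  then show ?thesis unfolding exp_decay_def using \<tau> by blast
qed

text \<open>The orbit of \<open>x\<close> contains the term \<open>t * l ^ (t - 1)\<close> times
  \<open>y\<close>, of norm \<open>t * norm y\<close>, while the other term stays bounded. Dividing
  by \<open>t\<close> leaves \<open>norm y\<close>.\<close>

lemma sublinear_unimodular_jordan:
  assumes x: "x \<in> V" "sublinear T x" and y: "y \<in> V" "T x = l *\<^sub>C x + y" "T y = l *\<^sub>C y" and l: "cmod l = 1"
  shows "y = 0"
proof -
  have pow: "(T ^^ Suc t) x = l ^ Suc t *\<^sub>C x + (of_nat (Suc t) * l ^ t) *\<^sub>C y" for t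
  proof (induction t)
    case (Suc t)
    have "(T ^^ Suc (Suc t)) x = T ((T ^^ Suc t) x)" by simp
    also have "\<dots> = l ^ Suc t *\<^sub>C (l *\<^sub>C x + y) + (of_nat (Suc t) * l ^ t) *\<^sub>C (l *\<^sub>C y)"
      unfolding Suc using x y by (simp only: T_add T_scale mem_scale)
    also have "\<dots> = l ^ Suc (Suc t) *\<^sub>C x + (l ^ Suc t + of_nat (Suc t) * l ^ t * l) *\<^sub>C y"
      by (simp only: scaleC_add_right scaleC_scaleC scaleC_add_left power_Suc2[of l "Suc t"] add.assoc)
    also have "l ^ Suc t + of_nat (Suc t) * l ^ t * l = of_nat (Suc (Suc t)) * l ^ Suc t"
      by (simp add: algebra_simps)
    finally show ?case .
  qed (use y in simp)
  have "norm y \<le> 0"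
  proof (rule LIMSEQ_le_const)
    have "(\<lambda>t. norm ((T ^^ Suc t) x) / real (Suc t) + norm x * inverse (real (Suc t))) \<longlonglongrightarrow> 0 + norm x * 0"
      using LIMSEQ_Suc[OF x(2)[unfolded sublinear_def]] LIMSEQ_inverse_real_of_nat
      by (intro tendsto_add tendsto_mult tendsto_const)
    then show "(\<lambda>t. norm ((T ^^ Suc t) x) / real (Suc t) + norm x * inverse (real (Suc t))) \<longlonglongrightarrow> 0" by simp
    have "norm y \<le> norm ((T ^^ Suc t) x) / real (Suc t) + norm x * inverse (real (Suc t))" for t
    proof -
      have "real (Suc t) * norm y = norm ((T ^^ Suc t) x - l ^ Suc t *\<^sub>C x)"
        unfolding pow using l by (simp add: norm_scaleC norm_mult norm_power del: of_nat_Suc)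
      also have "\<dots> \<le> norm ((T ^^ Suc t) x) + norm x"
        using norm_triangle_ineq4[of "(T ^^ Suc t) x" "l ^ Suc t *\<^sub>C x"] l
        by (simp add: norm_scaleC norm_mult norm_power)
      finally have "norm y \<le> (norm ((T ^^ Suc t) x) + norm x) / real (Suc t)"
        by (simp add: pos_le_divide_eq mult.commute del: funpow.simps)
      then show ?thesis by (simp only: distrib_right divide_inverse)
    qed
    then show "\<exists>N. \<forall>n\<ge>N. norm y \<le> norm ((T ^^ Suc n) x) / real (Suc n) + norm x * inverse (real (Suc n))"
      by blast
  qed
  then show ?thesis by simp
qed

text \<open>By Bernoulli's inequality \<open>cmod l ^ t\<close> is at least
  \<open>t * (cmod l - 1)\<close>, already too much for growth o(t).\<close>

lemma sublinear_expanding_eigenvector: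
  assumes x: "x \<in> V" "sublinear T x" "T x = l *\<^sub>C x" and l: "cmod l > 1"
  shows "x = 0"
proof -
  have "(cmod l - 1) * norm x \<le> 0"
  proof (rule LIMSEQ_le_const)
    show "(\<lambda>t. norm ((T ^^ t) x) / real t) \<longlonglongrightarrow> 0" using x(2) by (simp add: sublinear_def)
    have "(cmod l - 1) * norm x \<le> norm ((T ^^ t) x) / real t" if "t \<ge> 1" for t
    proof -
      have "real t * (cmod l - 1) \<le> cmod l ^ t"
        using Bernoulli_inequality[of "cmod l - 1" t] l by simp
      then have "real t * (cmod l - 1) * norm x \<le> cmod l ^ t * norm x"
        by (rule mult_right_mono) simp
      also have "\<dots> = norm ((T ^^ t) x)"
        by (simp add: eigenvector_funpow[OF bop x(1,3)] norm_scaleC norm_power)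
      finally show ?thesis using that by (simp add: pos_le_divide_eq mult_ac)
    qed
    then show "\<exists>N. \<forall>n\<ge>N. (cmod l - 1) * norm x \<le> norm ((T ^^ n) x) / real n" by blast
  qed
  then show ?thesis using l by (simp add: mult_le_0_iff)
qed

text \<open>The summands of \<open>T x - l x\<close> are pulled back through \<open>T - l\<close>:
  an eigenvector for \<mu> other than \<open>l\<close> by division by \<open>\<mu> - l\<close>, the
  decaying part by \<open>solve_decaying\<close> if \<open>cmod l \<ge> 1\<close>. The remainder
  satisfies \<open>T x2 = l x2 + y0\<close> and is sublinear, so it is an eigenvector for
  \<open>l\<close>, and zero if \<open>cmod l > 1\<close>. If \<open>cmod l < 1\<close>, the
  remainder before treating the decaying part decays itself.\<close>

lemma unimodular_plus_decay_step:
  assumes x: "x \<in> V" "sublinear T x" and nice: "unimodular_plus_decay (T x - l *\<^sub>C x)"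
  shows "unimodular_plus_decay x"
proof -
  obtain M y d where M: "finite M"
      and y: "\<And>\<mu>. \<mu> \<in> M \<Longrightarrow> cmod \<mu> = 1" "\<And>\<mu>. \<mu> \<in> M \<Longrightarrow> y \<mu> \<in> V" "\<And>\<mu>. \<mu> \<in> M \<Longrightarrow> T (y \<mu>) = \<mu> *\<^sub>C y \<mu>"
      and d: "d \<in> V" "exp_decay T d" and eq: "T x - l *\<^sub>C x = (\<Sum>\<mu>\<in>M. y \<mu>) + d"
    using nice unfolding unimodular_plus_decay_def by blast
  let ?M = "M - {l}"
  define u where "u \<mu> = inverse (\<mu> - l) *\<^sub>C y \<mu>" for \<mu>
  have uV: "u \<mu> \<in> V" and Tu: "T (u \<mu>) = \<mu> *\<^sub>C u \<mu>" if "\<mu> \<in> M" for \<mu>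
    using y that by (simp_all add: u_def mem_scale T_scale scaleC_scaleC mult.commute)
  define g where "g = sum u ?M"
  have gV: "g \<in> V" unfolding g_def by (intro mem_sum uV) auto
  have "sublinear T g"
  proof (rule sublinear_if_bounded)
    fix t
    have "(T ^^ t) g = (\<Sum>\<mu>\<in>?M. \<mu> ^ t *\<^sub>C u \<mu>)"
      unfolding g_def
      by (subst pow_sum) (use uV in \<open>auto intro!: sum.cong eigenvector_funpow[OF bop uV Tu]\<close>)
    then show "norm ((T ^^ t) g) \<le> (\<Sum>\<mu>\<in>?M. norm (u \<mu>))"
      using y(1) by (auto simp: norm_scaleC norm_power intro!: sum_norm_le)
  qed
  define x1 where "x1 = x - g"
  have x1: "x1 \<in> V" "sublinear T x1"
    unfolding x1_def using x gV \<open>sublinear T g\<close> by (auto intro: mem_diff sublinear_diff)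
  \<comment> \<open>The resonant summand, where division by \<open>\<mu> - l\<close> is impossible.
    It can be nonzero only for unimodular \<open>l\<close>.\<close>
  define y0 where "y0 = (if l \<in> M then y l else 0)"
  have y0: "y0 \<in> V" "T y0 = l *\<^sub>C y0" using y mem_zero T_zero by (auto simp: y0_def)
  have "T g - l *\<^sub>C g = sum y ?M"
  proof -
    have "T g - l *\<^sub>C g = (\<Sum>\<mu>\<in>?M. (\<mu> - l) *\<^sub>C u \<mu>)"
    proof -
      have "T g = (\<Sum>\<mu>\<in>?M. \<mu> *\<^sub>C u \<mu>)"
        unfolding g_def by (subst T_sum) (use uV Tu in \<open>auto intro!: sum.cong\<close>)
      then show ?thesis
        by (simp add: g_def complex_vector.scale_sum_right sum_subtractf complex_vector.scale_left_diff_distrib)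
    qed
    also have "\<dots> = sum y ?M" by (intro sum.cong) (auto simp: u_def scaleC_scaleC)
    finally show ?thesis .
  qed
  moreover have "sum y M = y0 + sum y ?M"
    using M by (simp add: y0_def sum.remove)
  moreover have "T x1 - l *\<^sub>C x1 = (T x - l *\<^sub>C x) - (T g - l *\<^sub>C g)"
    unfolding x1_def using x gV by (simp add: T_diff complex_vector.scale_right_diff_distrib)
  ultimately have Tx1: "T x1 - l *\<^sub>C x1 = y0 + d"
    unfolding eq by simp
  have y0_0: "y0 = 0" if "cmod l \<noteq> 1" using y(1) that by (auto simp: y0_def)
  have finish: "unimodular_plus_decay (g + c)" if "c \<in> V" "exp_decay T c" for c
    unfolding unimodular_plus_decay_def g_def
    using that M y uV Tu by (intro exI[of _ ?M] exI[of _ u] exI[of _ c]) auto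
  show ?thesis
  proof (cases "cmod l < 1")
    case True
    then have "T x1 = l *\<^sub>C x1 + d" using Tx1 y0_0 by (simp add: diff_eq_eq add.commute)
    then have "exp_decay T x1" using exp_decay_if_contracting[OF x1(1) d True] by simp
    then show ?thesis using finish[OF x1(1)] by (simp add: x1_def)
  next
    case False
    obtain C \<rho> where C: "0 < \<rho>" "\<rho> < 1" "\<And>t. norm ((T ^^ t) d) \<le> C * \<rho> ^ t"
      using d unfolding exp_decay_def by blast
    obtain c where c: "c \<in> V" "T c - l *\<^sub>C c = d" "\<And>t. norm ((T ^^ t) c) \<le> (C / (1 - \<rho>)) * \<rho> ^ t"
      by (rule solve_decaying[OF d(1) C(3,1,2)]) (use False in auto)
    then have cd: "exp_decay T c" unfolding exp_decay_def using C by blast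
    define x2 where "x2 = x1 - c"
    have "sublinear T c" using exp_decay_bounded[OF cd] sublinear_if_bounded by blast
    then have x2: "x2 \<in> V" "sublinear T x2"
      unfolding x2_def using x1 c by (auto intro: mem_diff sublinear_diff)
    have "T x2 - l *\<^sub>C x2 = (T x1 - l *\<^sub>C x1) - (T c - l *\<^sub>C c)"
      unfolding x2_def using x1 c(1) by (simp add: T_diff complex_vector.scale_right_diff_distrib)
    then have Tx2: "T x2 = l *\<^sub>C x2 + y0" unfolding Tx1 c(2) by (simp add: diff_eq_eq add.commute)
    have xx: "x = g + x2 + c" by (simp add: x2_def x1_def)
    show ?thesis
    proof (cases "cmod l = 1")
      case True
      have "y0 = 0" by (rule sublinear_unimodular_jordan[OF x2 y0(1) Tx2 y0(2) True])
      \<comment> \<open>The eigenvector \<open>x2\<close> becomes the component of \<open>x\<close>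
        at \<open>l\<close>.\<close>
      let ?u = "u(l := x2)"
      have "sum ?u (insert l ?M) = x2 + sum ?u ?M" using M by (subst sum.insert) auto
      also have "sum ?u ?M = g" unfolding g_def by (intro sum.cong) auto
      finally have s: "sum ?u (insert l ?M) = x2 + g" .
      show ?thesis
        unfolding unimodular_plus_decay_def
      proof (intro exI conjI ballI)
        show "finite (insert l ?M)" using M by simp
        show "x = sum ?u (insert l ?M) + c" unfolding s using xx by (simp add: add_ac)
        show "cmod \<mu> = 1" "?u \<mu> \<in> V" "T (?u \<mu>) = \<mu> *\<^sub>C ?u \<mu>" if "\<mu> \<in> insert l ?M" for \<mu>
          using that y True uV Tu x2 Tx2 \<open>y0 = 0\<close> by (cases "\<mu> = l"; auto)+
      qed (use c cd in auto)
    next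
      case l: False
      then have "T x2 = l *\<^sub>C x2" "cmod l > 1" using Tx2 y0_0 False by auto
      then have "x2 = 0" using sublinear_expanding_eigenvector[OF x2] by blast
      then show ?thesis using xx finish[OF c(1) cd] by simp
    qed
  qed
qed

section \<open>Polynomials in T and the peeling of their linear factors\<close>

definition poly_op :: "complex poly \<Rightarrow> 'a \<Rightarrow> 'a" where
  "poly_op p x = (\<Sum>i\<le>degree p. coeff p i *\<^sub>C (T ^^ i) x)"

lemma poly_op_altdef:
  assumes "degree p \<le> n"
  shows "poly_op p x = (\<Sum>i\<le>n. coeff p i *\<^sub>C (T ^^ i) x)"
  unfolding poly_op_def using assms
  by (intro sum.mono_neutral_left) (auto simp: coeff_eq_0)

lemma poly_op_linear_factor:
  assumes x: "x \<in> V"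
  shows "poly_op ([:- z, 1:] * q) x = poly_op q (T x - z *\<^sub>C x)"
proof -
  let ?n = "degree q"
  have p: "[:- z, 1:] * q = pCons 0 q - smult z q" by simp
  have "degree (pCons 0 q) \<le> Suc ?n" "degree (smult z q) \<le> Suc ?n"
    by (simp_all add: degree_pCons_le le_SucI order_trans[OF degree_smult_le])
  then have "degree ([:- z, 1:] * q) \<le> Suc ?n" unfolding p by (rule degree_diff_le)
  then have "poly_op ([:- z, 1:] * q) x = (\<Sum>i\<le>Suc ?n. coeff (pCons 0 q - smult z q) i *\<^sub>C (T ^^ i) x)"
    by (simp only: poly_op_altdef p)
  also have "\<dots> = (\<Sum>i\<le>Suc ?n. coeff (pCons 0 q) i *\<^sub>C (T ^^ i) x) - (\<Sum>i\<le>Suc ?n. (z * coeff q i) *\<^sub>C (T ^^ i) x)"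
    by (simp add: complex_vector.scale_left_diff_distrib sum_subtractf del: sum.atMost_Suc)
  also have "(\<Sum>i\<le>Suc ?n. coeff (pCons 0 q) i *\<^sub>C (T ^^ i) x) = (\<Sum>i\<le>?n. coeff q i *\<^sub>C (T ^^ i) (T x))"
    by (subst sum.atMost_Suc_shift) (simp add: funpow_swap1)
  also have "(\<Sum>i\<le>Suc ?n. (z * coeff q i) *\<^sub>C (T ^^ i) x) = (\<Sum>i\<le>?n. coeff q i *\<^sub>C (T ^^ i) (z *\<^sub>C x))"
    using x by (simp add: coeff_eq_0 pow_scale scaleC_scaleC mult.commute)
  also have "(\<Sum>i\<le>?n. coeff q i *\<^sub>C (T ^^ i) (T x)) - (\<Sum>i\<le>?n. coeff q i *\<^sub>C (T ^^ i) (z *\<^sub>C x)) = poly_op q (T x - z *\<^sub>C x)"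
    unfolding poly_op_def
    using x by (simp add: pow_diff T_mem mem_scale complex_vector.scale_right_diff_distrib sum_subtractf)
  finally show ?thesis .
qed

text \<open>The linear factor acts on \<open>x\<close> first, so the induction hypothesis concerns
  \<open>T x - z x\<close>, whose orbit is again sublinear;
  \<open>unimodular_plus_decay_step\<close> then returns to \<open>x\<close>.\<close>

lemma unimodular_plus_decay_poly:
  assumes "p \<noteq> 0" "x \<in> V" "sublinear T x" "unimodular_plus_decay (poly_op p x)"
  shows "unimodular_plus_decay x"
  using assms
proof (induction "degree p" arbitrary: p x)
  case 0
  then obtain c where c: "p = [:c:]" "c \<noteq> 0" by (metis degree_eq_zeroE pCons_0_0)
  have "unimodular_plus_decay (inverse c *\<^sub>C c *\<^sub>C x)"
    by (rule unimodular_plus_decay_scale[of "c *\<^sub>C x"]) (use 0 c in \<open>simp add: poly_op_def\<close>)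
  then show ?case using c by (simp add: scaleC_scaleC)
next
  case (Suc n)
  have "\<not> constant (poly p)" using Suc(2) constant_degree[of p] by simp
  then obtain z where "poly p z = 0" using fundamental_theorem_of_algebra by blast
  then obtain q where q: "p = [:- z, 1:] * q" unfolding poly_eq_0_iff_dvd dvd_def by blast
  have q0: "q \<noteq> 0" using Suc(3) q by auto
  have dq: "n = degree q"
    using Suc(2) q0 unfolding q by (subst (asm) degree_mult_eq) auto
  have "unimodular_plus_decay (poly_op q (T x - z *\<^sub>C x))"
    using Suc.prems(4) unfolding q poly_op_linear_factor[OF Suc.prems(2)] .
  moreover have "T x - z *\<^sub>C x \<in> V" using Suc.prems by (intro mem_diff T_mem mem_scale)
  moreover have "sublinear T (T x - z *\<^sub>C x)"
    using Suc.prems by (intro sublinear_diff sublinear_T sublinear_scale T_mem mem_scale)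
  ultimately have "unimodular_plus_decay (T x - z *\<^sub>C x)"
    using Suc.hyps(1)[OF dq q0] by blast
  then show ?case using unimodular_plus_decay_step[OF Suc.prems(2,3)] by blast
qed

lemma annihilating_poly:
  assumes E: "finite_dim E" "\<And>y. y \<in> E \<Longrightarrow> T y \<in> E" and e: "e \<in> E"
  obtains p where "p \<noteq> 0" "poly_op p e = 0"
proof -
  obtain B where B: "finite B" "E \<subseteq> complex_vector.span B"
    using E(1) unfolding finite_dim_def by blast
  let ?n = "card B"
  let ?f = "\<lambda>i. (T ^^ i) e"
  have mem: "?f i \<in> E" for i by (induction i) (use E e in auto)
  have "\<exists>c. (\<exists>i\<le>?n. c i \<noteq> 0) \<and> (\<Sum>i\<le>?n. c i *\<^sub>C ?f i) = 0"
  \<comment> \<open>Linear dependence refers to the set of iterates, in which equal iterates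
    collapse. If the iterates \<open>i\<close> and \<open>j\<close> coincide, the polynomial X^i -
    X^j serves.\<close>
  proof (cases "inj_on ?f {..?n}")
    case True
    then have card: "card (?f ` {..?n}) = Suc ?n" by (simp add: card_image)
    have "?f ` {..?n} \<subseteq> complex_vector.span B" using mem B(2) by auto
    then have "complex_vector.dependent (?f ` {..?n})"
      using complex_vector.independent_span_bound[OF B(1), of "?f ` {..?n}"] card by force
    then obtain u where u: "\<exists>v\<in>?f ` {..?n}. u v \<noteq> 0" "(\<Sum>v\<in>?f ` {..?n}. u v *\<^sub>C v) = 0"
      using complex_vector.dependent_finite[of "?f ` {..?n}"] by auto
    show ?thesis
      using u sum.reindex[OF True, of "\<lambda>v. u v *\<^sub>C v"]
      by (intro exI[of _ "\<lambda>i. u (?f i)"]) auto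
  next
    case False
    then obtain i j where ij: "i \<le> ?n" "j \<le> ?n" "i \<noteq> j" "?f i = ?f j"
      unfolding inj_on_def by auto
    let ?c = "\<lambda>k. (if k = i then 1 else 0) - (if k = j then 1 else 0) :: complex"
    have "(\<Sum>k\<le>?n. ?c k *\<^sub>C ?f k) = (\<Sum>k\<le>?n. if k = i then ?f i else 0) - (\<Sum>k\<le>?n. if k = j then ?f j else 0)"
      unfolding sum_subtractf[symmetric]
      by (intro sum.cong) (auto simp: complex_vector.scale_left_diff_distrib)
    also have "\<dots> = 0" using ij by simp
    finally show ?thesis using ij by (intro exI[of _ ?c] conjI exI[of _ i]) auto
  qed
  then obtain c i where c: "i \<le> ?n" "c i \<noteq> 0" "(\<Sum>i\<le>?n. c i *\<^sub>C ?f i) = 0" by blast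
  let ?p = "\<Sum>i\<le>?n. monom (c i) i"
  have coeff: "coeff ?p k = (if k \<le> ?n then c k else 0)" for k
    by (simp add: coeff_sum)
  have "degree ?p \<le> ?n" by (rule degree_le) (simp add: coeff)
  then have "poly_op ?p e = 0"
    using c(3) by (simp add: poly_op_altdef coeff)
  moreover have "?p \<noteq> 0" using coeff[of i] c(1,2) by (metis coeff_0)
  ultimately show ?thesis using that by blast
qed

lemma unimodular_plus_decay_if_sublinear:
  assumes E: "E \<subseteq> V" "finite_dim E" "\<And>y. y \<in> E \<Longrightarrow> T y \<in> E" "e \<in> E"
    and w: "w \<in> V" "exp_decay T w" and sub: "sublinear T (e + w)"
  shows "unimodular_plus_decay (e + w)"
proof -
  have eV: "e \<in> V" using E by blast
  obtain C where "\<And>t. norm ((T ^^ t) w) \<le> C" using exp_decay_bounded[OF w(2)] by blast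
  then have "sublinear T w" by (rule sublinear_if_bounded)
  then have "sublinear T e"
    using sublinear_diff[OF sub _ mem_add[OF eV w(1)] w(1)] by simp
  moreover obtain p where p: "p \<noteq> 0" "poly_op p e = 0" using annihilating_poly[OF E(2-4)] by blast
  moreover have "exp_decay T 0"
    using bop_zero[OF pow_bop] by (auto simp: exp_decay_def intro!: exI[of _ 0] exI[of _ "1/2"])
  then have "unimodular_plus_decay 0"
    unfolding unimodular_plus_decay_def using mem_zero by (intro exI[of _ "{}"] exI[of _ 0]) auto
  ultimately have "unimodular_plus_decay e"
    using unimodular_plus_decay_poly[OF p(1) eV] by simp
  then show ?thesis using unimodular_plus_decay_add w by blast
qed

end

section \<open>Averages and the spectral projection at one\<close>

context closed_operator
begin

text \<open>By \<open>moment_shift\<close> the spectral projection of \<open>c 0\<close> equals the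
  moment of order \<open>n + 1\<close> of \<open>c n\<close>. Its norm is bounded by a multiple of
  \<open>(r * q) ^ n\<close>.\<close>

lemma moment_vanishes:
  assumes r: "r > 0" and circle: "sphere l r \<inter> \<sigma> = {}"
    and c: "\<And>n. c n \<in> V" "\<And>n. T (c (Suc n)) - l *\<^sub>C c (Suc n) = c n"
    and bound: "\<And>n. norm (c n) \<le> C * q ^ n" and q: "q \<ge> 0" "r * q < 1"
  shows "moment l r 1 (c 0) = 0"
proof -
  obtain M where M: "M \<ge> 0" "\<And>z x. z \<in> sphere l r \<Longrightarrow> x \<in> V \<Longrightarrow> norm (R z x) \<le> M * norm x"
    using resolvent_bounded_on_compact[OF compact_sphere circle] by blast
  have shift: "moment l r 1 (c 0) = moment l r (Suc n) (c n)" for n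
  proof (induction n)
    case (Suc n)
    then show ?case using moment_shift[OF r circle c(1), of "Suc n" "Suc n"] c(2)[of n] by simp
  qed simp
  have le: "norm (moment l r 1 (c 0)) \<le> (r * M * C) * (r * q) ^ n" for n
  proof -
    have "norm (moment l r 1 (c 0)) \<le> r ^ Suc n * (M * norm (c n))"
      unfolding shift[of n] by (rule moment_norm[OF r circle M(2) c(1)])
    also have "\<dots> \<le> r ^ Suc n * (M * (C * q ^ n))"
      using r M bound by (intro mult_left_mono) auto
    finally show ?thesis by (simp add: power_mult_distrib mult_ac)
  qed
  have "(\<lambda>n. (r * M * C) * (r * q) ^ n) \<longlonglongrightarrow> (r * M * C) * 0"
    using q r by (intro tendsto_mult_left LIMSEQ_realpow_zero) auto
  then have "norm (moment l r 1 (c 0)) \<le> 0"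
    by (intro LIMSEQ_le_const[of "\<lambda>n. (r * M * C) * (r * q) ^ n"]) (use le in auto)
  then show ?thesis by simp
qed

text \<open>The backward chain consists of the multiples of \<open>y\<close> by the powers of
  \<open>inverse (\<mu> - l)\<close>. Its growth is admissible since \<mu> lies outside the
  circle.\<close>

lemma moment_vanishes_eigenvector:
  assumes r: "r > 0" "sphere l r \<inter> \<sigma> = {}" "r < cmod (\<mu> - l)" and y: "y \<in> V" "T y = \<mu> *\<^sub>C y"
  shows "moment l r 1 y = 0"
proof -
  have nz: "\<mu> - l \<noteq> 0" using r by auto
  define c where "c n = inverse (\<mu> - l) ^ n *\<^sub>C y" for n
  have "moment l r 1 (c 0) = 0"
  proof (rule moment_vanishes[OF r(1,2), of c "norm y" "inverse (cmod (\<mu> - l))"])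
    show "c n \<in> V" for n unfolding c_def by (intro mem_scale y)
    show "norm (c n) \<le> norm y * inverse (cmod (\<mu> - l)) ^ n" for n
      by (simp add: c_def norm_scaleC norm_power norm_inverse)
    show "r * inverse (cmod (\<mu> - l)) < 1" using r nz by (simp add: field_simps)
    show "T (c (Suc n)) - l *\<^sub>C c (Suc n) = c n" for n
    proof -
      have "T (c (Suc n)) - l *\<^sub>C c (Suc n) = (inverse (\<mu> - l) ^ Suc n * (\<mu> - l)) *\<^sub>C y"
        unfolding c_def
        by (simp only: T_scale y scaleC_scaleC mult.commute[of l] right_diff_distrib
            complex_vector.scale_left_diff_distrib)
      also have "inverse (\<mu> - l) ^ Suc n * (\<mu> - l) = inverse (\<mu> - l) ^ n"
        using nz by simp
      finally show ?thesis by (simp add: c_def)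
    qed
  qed simp
  then show ?thesis by (simp add: c_def)
qed

text \<open>Each application of \<open>solve_decaying\<close> keeps the rate \<rho> and multiplies
  the constant by 1 / (1 - \<rho>), so the backward chain is admissible for radii below 1 -
  \<rho>.\<close>

lemma moment_vanishes_decaying:
  assumes d: "d \<in> V" "\<And>t. norm ((T ^^ t) d) \<le> C * \<rho> ^ t" and \<rho>: "0 < \<rho>" "\<rho> < 1"
    and r: "r > 0" "sphere 1 r \<inter> \<sigma> = {}" "r < 1 - \<rho>"
  shows "moment 1 r 1 d = 0"
proof -
  let ?q = "1 / (1 - \<rho>)"
  \<comment> \<open>The last conjunct pins the start of the chain produced by dependent
    choice.\<close>
  let ?P = "\<lambda>n c. c \<in> V \<and> (\<forall>t. norm ((T ^^ t) c) \<le> (C * ?q ^ n) * \<rho> ^ t) \<and> (n = 0 \<longrightarrow> c = d)"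
  have "\<exists>c. \<forall>n. ?P n (c n) \<and> T (c (Suc n)) - 1 *\<^sub>C c (Suc n) = c n"
  proof (rule dependent_nat_choice)
    show "\<exists>c. ?P 0 c" using d by auto
    fix c n assume c: "?P n c"
    obtain c' where "c' \<in> V" "T c' - 1 *\<^sub>C c' = c"
        "\<And>t. norm ((T ^^ t) c') \<le> (C * ?q ^ n / (1 - \<rho>)) * \<rho> ^ t"
      by (rule solve_decaying[of c "C * ?q ^ n" \<rho> 1]) (use c \<rho> in auto)
    then show "\<exists>c'. ?P (Suc n) c' \<and> T c' - 1 *\<^sub>C c' = c" by auto
  qed
  then obtain c where c: "\<And>n. c n \<in> V" "\<And>n t. norm ((T ^^ t) (c n)) \<le> (C * ?q ^ n) * \<rho> ^ t" "c 0 = d"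
      "\<And>n. T (c (Suc n)) - 1 *\<^sub>C c (Suc n) = c n"
    by blast
  have "moment 1 r 1 (c 0) = 0"
  proof (rule moment_vanishes[OF r(1,2), of c C ?q])
    show "c n \<in> V" "T (c (Suc n)) - 1 *\<^sub>C c (Suc n) = c n" for n by (rule c)+
    show "norm (c n) \<le> C * ?q ^ n" for n using c(2)[of 0 n] by simp
    show "r * ?q < 1" using r \<rho> by (simp add: pos_divide_less_eq)
  qed (use \<rho> in simp)
  then show ?thesis using c(3) by simp
qed

lemma moment_fixed:
  assumes "r > 0" "sphere l r \<inter> \<sigma> = {}" "y \<in> V" "T y = l *\<^sub>C y"
  shows "moment l r 1 y = y"
  using moment_shift[OF assms(1-3), of 0] assms(4) bop_zero[OF moment_bop[OF assms(1,2)]] by simp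

lemma circle_around_one:
  assumes "\<not> 1 islimpt \<sigma>" "finite M" "e > 0"
  obtains r where "r > 0" "sphere 1 r \<inter> \<sigma> = {}" "r < e" "\<And>\<mu>. \<mu> \<in> M \<Longrightarrow> \<mu> \<noteq> 1 \<Longrightarrow> r < cmod (\<mu> - 1)"
proof -
  obtain a where a: "a > 0" "\<And>z. z \<in> \<sigma> \<Longrightarrow> z \<noteq> 1 \<Longrightarrow> a \<le> dist z 1"
    using assms(1) unfolding islimpt_approachable by (metis not_less)
  obtain b where b: "b > 0" "\<And>z. z \<in> M \<Longrightarrow> z \<noteq> 1 \<Longrightarrow> b \<le> dist 1 z"
    using finite_set_avoid[OF assms(2), of 1] by blast
  let ?r = "min e (min a b) / 2"
  have "?r > 0" "?r < e" "?r < a" "?r < b" using a b assms(3) by (auto simp: min_def)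
  then show ?thesis
  proof (intro that[of ?r])
    show "sphere 1 ?r \<inter> \<sigma> = {}"
    proof (intro equals0I, elim IntE)
      fix z assume z: "z \<in> sphere 1 ?r" "z \<in> \<sigma>"
      then have "z \<noteq> 1" using \<open>?r > 0\<close> by auto
      from a(2)[OF z(2) this] z(1) \<open>?r < a\<close> show False by (simp add: dist_commute)
    qed
    show "?r < cmod (\<mu> - 1)" if "\<mu> \<in> M" "\<mu> \<noteq> 1" for \<mu>
      using b(2)[OF that] \<open>?r < b\<close> by (simp add: dist_norm norm_minus_commute)
  qed
qed

text \<open>The remainder is a coboundary \<open>T c - c\<close> with bounded orbit, so that its averages telescope.\<close>

lemma unimodular_plus_decay_coboundary:
  assumes "unimodular_plus_decay x"
  obtains y c C where "y \<in> V" "T y = y" "c \<in> V" "x = y + (T c - c)" "\<And>t. norm ((T ^^ t) c) \<le> C"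
    "\<not> 1 islimpt \<sigma> \<Longrightarrow> \<exists>r>0. sphere 1 r \<inter> \<sigma> = {} \<and> moment 1 r 1 x = y"
proof -
  obtain M y d where M: "finite M"
      and y: "\<And>\<mu>. \<mu> \<in> M \<Longrightarrow> cmod \<mu> = 1" "\<And>\<mu>. \<mu> \<in> M \<Longrightarrow> y \<mu> \<in> V" "\<And>\<mu>. \<mu> \<in> M \<Longrightarrow> T (y \<mu>) = \<mu> *\<^sub>C y \<mu>"
      and d: "d \<in> V" "exp_decay T d" and eq: "x = (\<Sum>\<mu>\<in>M. y \<mu>) + d"
    using assms unfolding unimodular_plus_decay_def by blast
  obtain C \<rho> where C: "0 < \<rho>" "\<rho> < 1" "\<And>t. norm ((T ^^ t) d) \<le> C * \<rho> ^ t"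
    using d unfolding exp_decay_def by blast
  obtain c where c: "c \<in> V" "T c - 1 *\<^sub>C c = d" "\<And>t. norm ((T ^^ t) c) \<le> (C / (1 - \<rho>)) * \<rho> ^ t"
    by (rule solve_decaying[OF d(1) C(3,1,2), of 1]) auto
  have "exp_decay T c" unfolding exp_decay_def using C c(3) by blast
  then obtain D where D: "\<And>t. norm ((T ^^ t) c) \<le> D" using exp_decay_bounded by blast
  define y1 where "y1 = (if 1 \<in> M then y 1 else 0)"
  have y1: "y1 \<in> V" "T y1 = y1" using y(2)[of 1] y(3)[of 1] mem_zero T_zero by (auto simp: y1_def)
  let ?M = "M - {1}"
  have sM: "sum y M = y1 + sum y ?M" using M by (simp add: y1_def sum.remove)
  define u where "u \<mu> = inverse (\<mu> - 1) *\<^sub>C y \<mu>" for \<mu>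
  have uV: "u \<mu> \<in> V" and Tu: "T (u \<mu>) = \<mu> *\<^sub>C u \<mu>" if "\<mu> \<in> M" for \<mu>
    using y that by (simp_all add: u_def mem_scale T_scale scaleC_scaleC mult.commute)
  define g where "g = sum u ?M"
  have gV: "g \<in> V" unfolding g_def by (intro mem_sum uV) auto
  have pow_g: "(T ^^ t) g = (\<Sum>\<mu>\<in>?M. \<mu> ^ t *\<^sub>C u \<mu>)" for t
    unfolding g_def
    by (subst pow_sum) (use uV in \<open>auto intro!: sum.cong eigenvector_funpow[OF bop uV Tu]\<close>)
  have "T g - g = (\<Sum>\<mu>\<in>?M. (\<mu> - 1) *\<^sub>C u \<mu>)"
    using pow_g[of 1] by (simp add: g_def sum_subtractf complex_vector.scale_left_diff_distrib)
  also have "\<dots> = sum y ?M" by (intro sum.cong) (auto simp: u_def scaleC_scaleC)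
  finally have Tg: "T g - g = sum y ?M" .
  have g_norm: "norm ((T ^^ t) g) \<le> (\<Sum>\<mu>\<in>?M. norm (u \<mu>))" for t
    unfolding pow_g using y(1) by (auto simp: norm_scaleC norm_power intro!: sum_norm_le)
  show ?thesis
  proof (rule that[OF y1, of "g + c" "(\<Sum>\<mu>\<in>?M. norm (u \<mu>)) + D"])
    show "g + c \<in> V" using gV c mem_add by blast
    have "T (g + c) - (g + c) = (T g - g) + (T c - 1 *\<^sub>C c)"
      using gV c(1) by (simp add: T_add)
    then show "x = y1 + (T (g + c) - (g + c))" unfolding Tg c(2) eq sM by (simp add: add_ac)
    show "norm ((T ^^ t) (g + c)) \<le> (\<Sum>\<mu>\<in>?M. norm (u \<mu>)) + D" for t
      using pow_add[OF gV c(1), of t] norm_triangle_mono[OF g_norm D] by simp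
    assume lim: "\<not> 1 islimpt \<sigma>"
    \<comment> \<open>With this radius the eigenvalues other than 1 lie outside the circle and the
      decaying part falls under \<open>moment_vanishes_decaying\<close>; only \<open>y1\<close>
      survives.\<close>
    obtain r where r: "r > 0" "sphere 1 r \<inter> \<sigma> = {}" "r < 1 - \<rho>"
        "\<And>\<mu>. \<mu> \<in> M \<Longrightarrow> \<mu> \<noteq> 1 \<Longrightarrow> r < cmod (\<mu> - 1)"
      by (rule circle_around_one[OF lim M, of "1 - \<rho>"]) (use C in auto)
    note P = moment_bop[OF r(1,2), of 1]
    have "sum y ?M \<in> V" using y(2) by (intro mem_sum) auto
    then have "moment 1 r 1 x = moment 1 r 1 y1 + (moment 1 r 1 (sum y ?M) + moment 1 r 1 d)"
      unfolding eq sM using y1 d by (simp only: bop_add[OF P] mem_add add.assoc)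
    also have "moment 1 r 1 (sum y ?M) = (\<Sum>\<mu>\<in>?M. moment 1 r 1 (y \<mu>))"
      by (rule bop_sum[OF P]) (use y(2) in auto)
    also have "\<dots> = 0"
      using moment_vanishes_eigenvector[OF r(1,2) r(4) y(2,3)] by (intro sum.neutral) auto
    also have "moment 1 r 1 d = 0" by (rule moment_vanishes_decaying[OF d(1) C(3,1,2) r(1-3)])
    also have "moment 1 r 1 y1 = y1" by (rule moment_fixed[OF r(1,2) y1(1)]) (use y1 in simp)
    finally show "\<exists>r>0. sphere 1 r \<inter> \<sigma> = {} \<and> moment 1 r 1 x = y1" using r by auto
  qed
qed

lemma coboundary_average:
  assumes y: "y \<in> V" "T y = y" and c: "c \<in> V" "\<And>t. norm ((T ^^ t) c) \<le> C"
  shows "(\<lambda>t. (1 / real t) *\<^sub>R (\<Sum>m = 1..t. (T ^^ m) (y + (T c - c)))) \<longlonglongrightarrow> y"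
proof -
  have "(T ^^ m) (y + (T c - c)) = y + ((T ^^ Suc m) c - (T ^^ m) c)" for m
  proof -
    have "(T ^^ m) y = y" by (induction m) (simp_all add: y)
    then show ?thesis using y c(1) by (simp add: pow_add pow_diff mem_diff T_mem funpow_swap1)
  qed
  then have sum: "(\<Sum>m = 1..t. (T ^^ m) (y + (T c - c))) = real t *\<^sub>R y + ((T ^^ Suc t) c - T c)" for t
    using sum_Suc_diff[of 1 t "\<lambda>m. (T ^^ m) c"]
    by (simp add: sum.distrib sum_constant_scaleR del: funpow.simps(2)) simp
  have "(\<lambda>t. y + (1 / real t) *\<^sub>R ((T ^^ Suc t) c - T c)) \<longlonglongrightarrow> y + 0"
  proof (intro tendsto_add tendsto_const)
    have "(\<lambda>t. (C + norm (T c)) * inverse (real t)) \<longlonglongrightarrow> 0"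
      using tendsto_mult_left[OF lim_inverse_n[where 'a = real], of "C + norm (T c)"] by simp
    then show "(\<lambda>t. (1 / real t) *\<^sub>R ((T ^^ Suc t) c - T c)) \<longlonglongrightarrow> 0"
    proof (rule Lim_null_comparison[rotated])
      have "norm ((T ^^ Suc t) c - T c) \<le> C + norm (T c)" for t
        using norm_triangle_ineq4[of "(T ^^ Suc t) c" "T c"] c(2)[of "Suc t"] by linarith
      then show "\<forall>\<^sub>F t in sequentially. norm ((1 / real t) *\<^sub>R ((T ^^ Suc t) c - T c)) \<le> (C + norm (T c)) * inverse (real t)"
        by (intro always_eventually allI) (simp add: divide_inverse mult.commute mult_left_mono del: funpow.simps)
    qed
  qed
  \<comment> \<open>At \<open>t = 0\<close> the left side is \<open>y\<close> and the average is 0,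
    so the equality holds only eventually.\<close>
  moreover have "\<forall>\<^sub>F t in sequentially. y + (1 / real t) *\<^sub>R ((T ^^ Suc t) c - T c) =
      (1 / real t) *\<^sub>R (\<Sum>m = 1..t. (T ^^ m) (y + (T c - c)))"
    using eventually_gt_at_top[of 0]
    by eventually_elim (simp only: sum scaleR_add_right scaleR_scaleR, simp)
  ultimately show ?thesis using Lim_transform_eventually by fastforce
qed

text \<open>The spectrum is bounded, so infinitely many such points would accumulate at a point of
  modulus at least 1.\<close>

lemma finite_spectrum_outside_disc:
  assumes "\<And>z. z islimpt \<sigma> \<Longrightarrow> z = 0"
  shows "finite {z \<in> \<sigma>. cmod z \<ge> 1}"
proof (rule ccontr)
  let ?S = "{z \<in> \<sigma>. cmod z \<ge> 1}"
  assume inf: "infinite ?S"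
  obtain K where K: "K \<ge> 0" "\<And>x. x \<in> V \<Longrightarrow> norm (T x) \<le> K * norm x"
    using bop_bound[OF bop] by blast
  have "?S \<subseteq> cball 0 (2 * K + 2)"
    using resolvent_outside(1)[OF K] by force
  then obtain z where z: "z islimpt ?S"
    using compact_eq_Bolzano_Weierstrass[of "cball (0::complex) (2 * K + 2)"] inf by auto
  have "z islimpt {z. cmod z \<ge> 1}" by (rule islimpt_subset[OF z]) auto
  moreover have "closed {z. cmod z \<ge> 1}" by (intro closed_Collect_le continuous_intros)
  ultimately have "cmod z \<ge> 1" using closed_limpt by blast
  moreover have "z = 0" by (rule assms, rule islimpt_subset[OF z]) auto
  ultimately show False by simp
qed

end

section \<open>The evolution\<close>

text \<open>A finitary evolution requires an operator that is linear on the whole type, whereas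
  \<open>T\<close> is controlled only on \<open>V\<close>. The restriction to \<open>E\<close> is
  therefore extended from a basis.\<close>

lemma linear_extension_of_restriction:
  fixes E :: "'a::complex_normed_vector set"
  assumes E: "complex_vector.subspace E" "E \<subseteq> V" and T: "bounded_operator_on V T"
  obtains \<phi> :: "'a \<Rightarrow> 'a" where "clinear \<phi>" "\<And>x. x \<in> E \<Longrightarrow> \<phi> x = T x"
proof -
  have pair: "vector_space_pair (scaleC :: complex \<Rightarrow> 'a \<Rightarrow> 'a) (scaleC :: complex \<Rightarrow> 'a \<Rightarrow> 'a)"
    by (intro vector_space_pair.intro complex_vector.vector_space_axioms)
  obtain B where B: "B \<subseteq> E" "complex_vector.independent B" "E \<subseteq> complex_vector.span B"
    by (rule complex_vector.basis_exists[of E])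
  have "\<exists>\<phi>. clinear \<phi> \<and> (\<forall>x\<in>B. \<phi> x = T x)"
    by (rule vector_space_pair.linear_independent_extend[OF pair B(2)])
  then obtain \<phi> :: "'a \<Rightarrow> 'a" where \<phi>: "clinear \<phi>" "\<And>x. x \<in> B \<Longrightarrow> \<phi> x = T x"
    by blast
  have "complex_vector.subspace {x \<in> E. \<phi> x = T x}"
    unfolding complex_vector.subspace_def
  proof (intro conjI ballI allI)
    show "0 \<in> {x \<in> E. \<phi> x = T x}"
      using complex_vector.subspace_0[OF E(1)]
      by (simp add: vector_space_pair.linear_0[OF pair \<phi>(1)] bop_zero[OF T])
    show "x + y \<in> {x \<in> E. \<phi> x = T x}" if "x \<in> {x \<in> E. \<phi> x = T x}" "y \<in> {x \<in> E. \<phi> x = T x}" for x y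
      using that E(2) complex_vector.subspace_add[OF E(1)]
      by (simp add: vector_space_pair.linear_add[OF pair \<phi>(1)] bop_add[OF T] subset_iff)
    show "a *\<^sub>C x \<in> {x \<in> E. \<phi> x = T x}" if "x \<in> {x \<in> E. \<phi> x = T x}" for a x
      using that E(2) complex_vector.subspace_scale[OF E(1)]
      by (simp add: vector_space_pair.linear_scale[OF pair \<phi>(1)] bop_scaleC[OF T] subset_iff)
  qed
  then have "complex_vector.span B \<subseteq> {x \<in> E. \<phi> x = T x}"
    using B(1) \<phi>(2) by (intro complex_vector.span_minimal) auto
  then have "\<phi> x = T x" if "x \<in> E" for x using B(3) that by blast
  with \<phi>(1) show ?thesis by (rule that)
qed

lemma finitaryI:
  assumes T: "bounded_operator_on V T" and E: "complex_vector.subspace E" "E \<subseteq> V" "finite_dim E"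
      "\<And>y. y \<in> E \<Longrightarrow> T y \<in> E" "e \<in> E"
    and w: "w \<in> V" "exp_decay T w" and orbit: "\<And>t. (\<psi> ^^ t) s = (T ^^ t) (e + w)"
  shows "finitary \<psi> s"
proof -
  obtain \<phi> where \<phi>: "clinear \<phi>" "\<And>x. x \<in> E \<Longrightarrow> \<phi> x = T x"
    using linear_extension_of_restriction[OF E(1,2) T] by blast
  have pow: "(\<phi> ^^ t) e = (T ^^ t) e \<and> (T ^^ t) e \<in> E" for t
    by (induction t) (use E \<phi>(2) in auto)
  then have "range (\<lambda>t. (\<phi> ^^ t) e) \<subseteq> E" by auto
  then have "evolution_space \<phi> e \<subseteq> E"
    unfolding evolution_space_def using E(1) by (rule complex_vector.span_minimal)
  then have "finite_dim (evolution_space \<phi> e)" using E(3) finite_dim_subset by blast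
  moreover have "norm ((\<phi> ^^ t) e - (\<psi> ^^ t) s) = norm ((T ^^ t) w)" for t
    using E w pow by (simp add: orbit bop_add[OF bop_funpow[OF T]] subset_iff)
  then have "equivalent_evolutions \<psi> s \<phi> e"
    unfolding equivalent_evolutions_def using exp_decay_tendsto[OF w(2)] by (simp add: tendsto_norm_zero)
  ultimately show ?thesis unfolding finitary_def using \<phi>(1) by blast
qed

text \<open>With \<open>A\<close> denoting the averages,
  \<open>A (t + 1) - t / (t + 1) * A t\<close> is the iterate of order \<open>t + 1\<close> divided
  by \<open>t + 1\<close>, and both terms of the difference have the same limit.\<close>

lemma mean_ergodic_sublinear:
  assumes "mean_ergodic \<psi> s"
  shows "sublinear \<psi> s"
proof -
  obtain a where a: "evolution_average \<psi> s \<longlonglongrightarrow> a"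
    using assms unfolding mean_ergodic_def convergent_def by blast
  let ?A = "evolution_average \<psi> s"
  have "(\<lambda>t. ?A (Suc t) - (real t / real (Suc t)) *\<^sub>R ?A t) \<longlonglongrightarrow> a - 1 *\<^sub>R a"
    by (intro tendsto_diff tendsto_scaleR a LIMSEQ_Suc[OF a] LIMSEQ_n_over_Suc_n)
  moreover have "?A (Suc t) - (real t / real (Suc t)) *\<^sub>R ?A t = (1 / real (Suc t)) *\<^sub>R (\<psi> ^^ Suc t) s" for t
  proof (cases "t = 0")
    case False
    have "(real t / real (Suc t)) *\<^sub>R ?A t = (1 / real (Suc t)) *\<^sub>R (\<Sum>m = 1..t. (\<psi> ^^ m) s)"
      unfolding evolution_average_def using False by simp
    then show ?thesis
      by (simp add: evolution_average_def scaleR_add_right del: of_nat_Suc funpow.simps)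
  qed (simp add: evolution_average_def)
  ultimately have "(\<lambda>t. (1 / real (Suc t)) *\<^sub>R (\<psi> ^^ Suc t) s) \<longlonglongrightarrow> 0" by simp
  then have "(\<lambda>t. norm ((\<psi> ^^ Suc t) s) / real (Suc t)) \<longlonglongrightarrow> 0"
    by (drule_tac tendsto_norm_zero) (simp add: divide_inverse mult.commute del: of_nat_Suc funpow.simps)
  then show ?thesis
    unfolding sublinear_def by (rule LIMSEQ_imp_Suc)
qed

theorem theorem1:
  fixes \<psi> :: "'a::complex_banach \<Rightarrow> 'a" and s :: 'a and T :: "'a \<Rightarrow> 'a"
  defines "V \<equiv> closure (evolution_space \<psi> s)"
  assumes "clinear \<psi>"
    and "riesz_extension \<psi> s T"
  shows "finitary \<psi> s \<and>
    (mean_ergodic \<psi> s \<longleftrightarrow> stable_evolution \<psi> s) \<and>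
    (stable_evolution \<psi> s \<longrightarrow>
       (\<not> eigenvalue_on V T 1 \<longrightarrow> evolution_average \<psi> s \<longlonglongrightarrow> 0) \<and>
       (eigenvalue_on V T 1 \<longrightarrow>
          (\<exists>P\<^sub>1. projection_onto V (eigenspace_on V T 1) P\<^sub>1 \<and> evolution_average \<psi> s \<longlonglongrightarrow> P\<^sub>1 s)))"
proof -
  have riesz: "riesz_operator_on V T" and ext: "\<And>x. x \<in> evolution_space \<psi> s \<Longrightarrow> T x = \<psi> x"
    using assms(3) unfolding riesz_extension_def V_def by auto
  have "bounded_operator_on V T" using riesz unfolding riesz_operator_on_def by blast
  then interpret closed_operator V T by unfold_locales (simp_all add: V_def)
  have limpt: "\<And>z. z islimpt \<sigma> \<Longrightarrow> z = 0"
    and fin: "\<And>z. z \<in> \<sigma> \<Longrightarrow> z \<noteq> 0 \<Longrightarrow> finite_algebraic_multiplicity V T z"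
    using riesz unfolding riesz_operator_on_def by auto
  have orbit_mem: "(\<psi> ^^ t) s \<in> evolution_space \<psi> s" for t
    unfolding evolution_space_def by (intro complex_vector.span_base) auto
  have orbit: "(\<psi> ^^ t) s = (T ^^ t) s" for t
  proof (induction t)
    case (Suc t)
    then show ?case using ext[OF orbit_mem[of t]] by simp
  qed simp
  have sV: "s \<in> V" using orbit_mem[of 0] closure_subset unfolding V_def by auto
  have avg: "evolution_average \<psi> s = (\<lambda>t. (1 / real t) *\<^sub>R (\<Sum>m = 1..t. (T ^^ m) s))"
    by (simp add: evolution_average_def orbit fun_eq_iff)
  have sublin: "sublinear \<psi> s \<longleftrightarrow> sublinear T s" by (simp add: sublinear_def orbit)
  have "\<exists>E e w. complex_vector.subspace E \<and> E \<subseteq> V \<and> finite_dim E \<and> (\<forall>y\<in>E. T y \<in> E) \<and>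
      e \<in> E \<and> w \<in> V \<and> exp_decay T w \<and> s = e + w"
    by (rule finite_dim_plus_decay[OF finite_spectrum_outside_disc[OF limpt] closed_operator_axioms _ sV])
      (use fin in force)+
  then obtain E e w where E: "complex_vector.subspace E" "E \<subseteq> V" "finite_dim E" "\<And>y. y \<in> E \<Longrightarrow> T y \<in> E" "e \<in> E"
      and w: "w \<in> V" "exp_decay T w" and s: "s = e + w"
    by blast
  have finitary: "finitary \<psi> s"
    using finitaryI[OF bop E w] orbit s by simp
  \<comment> \<open>Phrased as an elimination rule because both directions of the equivalence and
    both limit statements start from this decomposition.\<close>
  have decomp: thesis
    if "sublinear \<psi> s" and *: "\<And>y c C. y \<in> V \<Longrightarrow> T y = y \<Longrightarrow> c \<in> V \<Longrightarrow> s = y + (T c - c) \<Longrightarrow>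
        (\<And>t. norm ((T ^^ t) c) \<le> C) \<Longrightarrow>
        \<exists>r>0. sphere 1 r \<inter> \<sigma> = {} \<and> moment 1 r 1 s = y \<Longrightarrow> thesis" for thesis
  proof -
    have "unimodular_plus_decay s"
      using unimodular_plus_decay_if_sublinear[OF E(2-5) w] that(1) sublin s by simp
    then show thesis
    proof (rule unimodular_plus_decay_coboundary)
      fix y c C
      assume a: "y \<in> V" "T y = y" "c \<in> V" "s = y + (T c - c)" "\<And>t. norm ((T ^^ t) c) \<le> C"
        "\<not> 1 islimpt \<sigma> \<Longrightarrow> \<exists>r>0. sphere 1 r \<inter> \<sigma> = {} \<and> moment 1 r 1 s = y"
      have "\<not> 1 islimpt \<sigma>" using limpt[of 1] by auto
      from *[OF a(1-5) a(6)[OF this]] show thesis .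
    qed
  qed
  have conv: "evolution_average \<psi> s \<longlonglongrightarrow> y"
    if "y \<in> V" "T y = y" "c \<in> V" "s = y + (T c - c)" "\<And>t. norm ((T ^^ t) c) \<le> C" for y c C
    using coboundary_average[OF that(1-3,5)] unfolding avg that(4)[symmetric] .
  have stable_sublinear: "sublinear \<psi> s" if "stable_evolution \<psi> s"
    using that sublinear_if_bounded unfolding stable_evolution_def by blast
  have "stable_evolution \<psi> s" if me: "mean_ergodic \<psi> s"
  proof (rule decomp[OF mean_ergodic_sublinear[OF me]])
    fix y c C assume y: "y \<in> V" "T y = y" and c: "c \<in> V" "s = y + (T c - c)" "\<And>t. norm ((T ^^ t) c) \<le> C"
    have bound: "norm ((T ^^ t) s) \<le> norm y + (C + C)" for t
    proof -
      have "(T ^^ t) y = y" by (induction t) (simp_all add: y)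
      then have "(T ^^ t) s = y + ((T ^^ Suc t) c - (T ^^ t) c)"
        unfolding c(2) using y c(1) by (simp add: pow_add pow_diff mem_diff T_mem funpow_swap1)
      also have "norm \<dots> \<le> norm y + (C + C)"
        by (intro norm_triangle_mono norm_triangle_le_diff order_refl add_mono c(3))
      finally show ?thesis .
    qed
    show "stable_evolution \<psi> s"
    \<comment> \<open>Stability is measured relative to \<open>norm s\<close>, so a constant bound
      on the orbit can be rescaled only for nonzero \<open>s\<close>.\<close>
    proof (cases "s = 0")
      case True
      then show ?thesis
        unfolding stable_evolution_def using orbit bop_zero[OF pow_bop] by auto
    next
      case False
      then have "norm ((\<psi> ^^ t) s) \<le> ((norm y + (C + C)) / norm s) * norm s" for t
        using bound by (simp add: orbit)
      then show ?thesis unfolding stable_evolution_def by blast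
    qed
  qed
  moreover have "mean_ergodic \<psi> s" if "stable_evolution \<psi> s"
  proof (rule decomp[OF stable_sublinear[OF that]])
    fix y c C assume "y \<in> V" "T y = y" "c \<in> V" "s = y + (T c - c)" "\<And>t. norm ((T ^^ t) c) \<le> C"
    from conv[OF this] show "mean_ergodic \<psi> s"
      unfolding mean_ergodic_def by (rule convergentI)
  qed
  moreover have "evolution_average \<psi> s \<longlonglongrightarrow> 0"
    if st: "stable_evolution \<psi> s" and ne: "\<not> eigenvalue_on V T 1"
  proof (rule decomp[OF stable_sublinear[OF st]])
    fix y c C assume y: "y \<in> V" "T y = y" and c: "c \<in> V" "s = y + (T c - c)" "\<And>t. norm ((T ^^ t) c) \<le> C"
    have "y = 0" using ne y unfolding eigenvalue_on_def eigenspace_on_def by auto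
    then show "evolution_average \<psi> s \<longlonglongrightarrow> 0" using conv[OF y c] by simp
  qed
  moreover have "\<exists>P. projection_onto V (eigenspace_on V T 1) P \<and> evolution_average \<psi> s \<longlonglongrightarrow> P s"
    if st: "stable_evolution \<psi> s"
  proof (rule decomp[OF stable_sublinear[OF st]])
    fix y c C assume y: "y \<in> V" "T y = y" and c: "c \<in> V" "s = y + (T c - c)" "\<And>t. norm ((T ^^ t) c) \<le> C"
      and "\<exists>r>0. sphere 1 r \<inter> \<sigma> = {} \<and> moment 1 r 1 s = y"
    then obtain r where r: "r > 0" "sphere 1 r \<inter> \<sigma> = {}" and Ps: "moment 1 r 1 s = y" by blast
    define P where "P = moment 1 r 1"
    have P: "bounded_operator_on V P" unfolding P_def by (rule moment_bop[OF r])
    have TP: "T (P x) = P (T x)" if "x \<in> V" for x unfolding P_def by (rule T_moment[OF r that])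
    have fixed: "P x = x" if "x \<in> V" "T x = x" for x
      unfolding P_def by (rule moment_fixed[OF r that(1)]) (use that in simp)
    \<comment> \<open>A closed subspace that contains the orbit of \<open>s\<close>, because
      \<open>P\<close> sends every iterate of \<open>s\<close> to the fixed vector \<open>y\<close>.
      It therefore contains \<open>V\<close>, so the range of \<open>P\<close> consists of fixed
      vectors; since \<open>P\<close> fixes these, it is idempotent.\<close>
    let ?W = "{x \<in> V. T (P x) - P x = 0}"
    note TPb = bop_comp[OF bop P]
    have "complex_vector.subspace ?W"
      unfolding complex_vector.subspace_def
      by (auto simp: bop_zero[OF TPb] bop_zero[OF P] bop_add[OF TPb] bop_add[OF P] bop_scaleC[OF TPb]
          bop_scaleC[OF P] T_zero T_add T_scale bop_mem[OF P] mem_zero mem_add mem_scale)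
    moreover have "(\<psi> ^^ t) s \<in> ?W" for t
    proof -
      have "P ((T ^^ t) s) = (T ^^ t) (P s)"
        using funpow_commute_on[of V T P s t] T_mem bop_mem[OF P] TP sV by simp
      also have "\<dots> = y" using Ps by (induction t) (simp_all add: P_def y)
      finally show ?thesis using y sV by (simp add: orbit pow_mem)
    qed
    ultimately have "evolution_space \<psi> s \<subseteq> ?W"
      unfolding evolution_space_def by (intro complex_vector.span_minimal) auto
    moreover have "closed ?W"
      by (intro continuous_closed_preimage_constant closed continuous_on_diff
          bop_continuous_on[OF TPb] bop_continuous_on[OF P])
    ultimately have "V \<subseteq> ?W" unfolding V_def by (rule closure_minimal)
    then have TPx: "T (P x) = P x" if "x \<in> V" for x using that by auto
    have "P ` V = eigenspace_on V T 1"
    proof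
      show "P ` V \<subseteq> eigenspace_on V T 1"
        using TPx bop_mem[OF P] by (auto simp: eigenspace_on_def)
      show "eigenspace_on V T 1 \<subseteq> P ` V"
        using fixed by (force simp: eigenspace_on_def)
    qed
    moreover have "P (P x) = P x" if "x \<in> V" for x
      using fixed[OF bop_mem[OF P that] TPx[OF that]] .
    moreover have "evolution_average \<psi> s \<longlonglongrightarrow> P s"
      using conv[OF y c] Ps by (simp add: P_def)
    ultimately show ?thesis using P unfolding projection_onto_def by blast
  qed
  ultimately show ?thesis using finitary by blast
qed

end
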